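(* Let $H$ be an iteratable endofunctor of a category $\mathcal A$ with finite coproducts, and let $\mathbb T$ be the free completely iterative monad of $H$. Then the category $\mathrm{CElgot}\,H$ of complete Elgot algebras and solution-preserving morphisms is isomorphic to the Eilenberg--Moore category $\mathcal A^{\mathbb T}$ of $\mathbb T$-algebras.
   Context: $H$ is iteratable if for every object $Y$ the functor $H(-)+Y$ has a final coalgebra $TY$; equivalently, free completely iterative $H$-algebras $TY$ exist on every object $Y$, and $\mathbb T$ is the monad arising from the free completely iterative algebra adjunction (it is the free completely iterative monad on $H$). Coproduct injections are $\mathrm{inl},\mathrm{inr}$. For an $H$-algebra $\alpha:HA\to A$, a flat equation morphism in $A$ is any morphism $e:X\to HX+A$; a solution is $e^\dagger:X\to A$ with $e^\dagger=[\alpha,\mathrm{id}_A]\cdot(He^\dagger+\mathrm{id}_A)\cdot e$; a completely iterative algebra is one where every flat equation morphism has a unique solution. For $e:X\to HX+Y$ and $h:Y\to Z$, $h\bullet e:=(\mathrm{id}_{HX}+h)\cdot e$; for $e:X\to HX+Y$, $f:Y\to HY+A$, $f\oplus e:=(\mathrm{can}+\mathrm{id}_A)\cdot(\mathrm{id}_{HX}+f)\cdot[e,\mathrm{inr}]$ with $\mathrm{can}=[H\mathrm{inl},H\mathrm{inr}]$. A complete Elgot algebra is an $H$-algebra with an assignment $e\mapsto e^\dagger$ of a solution to every flat equation morphism that is functorial ($e^\dagger=f^\dagger\cdot h$ whenever $e:X\to HX+A$, $f:Y\to HY+A$, $h:X\to Y$ with $(Hh+\mathrm{id}_A)\cdot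 e=f\cdot h$) and compositional ($(f^\dagger\bullet e)^\dagger=(f\oplus e)^\dagger\cdot\mathrm{inl}$ for all $e:X\to HX+Y$, $f:Y\to HY+A$). A morphism $h:A\to B$ of complete Elgot algebras $(A,\alpha,(-)^\dagger)$, $(B,\beta,(-)^\ddagger)$ is solution-preserving if $h\cdot e^\dagger=(h\bullet e)^\ddagger$ for every flat equation morphism $e$ in $A$. *)

theory Defs
  imports "HOL-Library.FuncSet"
begin

section \<open>Categories, functors, finite coproducts\<close>

record ('o, 'm) category =
  Obj :: "'o set"
  Arr :: "'m set"
  Dom :: "'m \<Rightarrow> 'o"
  Cod :: "'m \<Rightarrow> 'o"
  Id :: "'o \<Rightarrow> 'm"
  Comp :: "'m \<Rightarrow> 'm \<Rightarrow> 'm" (infixr "\<cdot>\<index>" 75)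

definition hom :: "('o, 'm, 'z) category_scheme \<Rightarrow> 'o \<Rightarrow> 'o \<Rightarrow> 'm set" where
  "hom C X Y = {f \<in> Arr C. Dom C f = X \<and> Cod C f = Y}"

locale category =
  fixes C :: "('o, 'm, 'z) category_scheme" (structure)
  assumes Dom_in_Obj: "f \<in> Arr C \<Longrightarrow> Dom C f \<in> Obj C"
    and Cod_in_Obj: "f \<in> Arr C \<Longrightarrow> Cod C f \<in> Obj C"
    and Id_in_hom: "X \<in> Obj C \<Longrightarrow> Id C X \<in> hom C X X"
    and Comp_in_hom: "f \<in> hom C X Y \<Longrightarrow> g \<in> hom C Y Z \<Longrightarrow> g \<cdot> f \<in> hom C X Z"
    and Comp_Id: "f \<in> hom C X Y \<Longrightarrow> f \<cdot> Id C X = f"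
    and Id_Comp: "f \<in> hom C X Y \<Longrightarrow> Id C Y \<cdot> f = f"
    and Comp_assoc: "f \<in> hom C W X \<Longrightarrow> g \<in> hom C X Y \<Longrightarrow> h \<in> hom C Y Z \<Longrightarrow>
      (h \<cdot> g) \<cdot> f = h \<cdot> (g \<cdot> f)"

record ('o, 'm, 'p, 'n) func =
  OMap :: "'o \<Rightarrow> 'p"
  AMap :: "'m \<Rightarrow> 'n"

locale cat_functor = C: category C + D: category D
  for C :: "('o, 'm, 'y) category_scheme" and D :: "('p, 'n, 'z) category_scheme"
    and F :: "('o, 'm, 'p, 'n) func" +
  assumes OMap_in_Obj: "X \<in> Obj C \<Longrightarrow> OMap F X \<in> Obj D"
    and AMap_in_hom: "f \<in> hom C X Y \<Longrightarrow> AMap F f \<in> hom D (OMap F X) (OMap F Y)"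
    and AMap_Id: "X \<in> Obj C \<Longrightarrow> AMap F (Id C X) = Id D (OMap F X)"
    and AMap_Comp: "f \<in> hom C X Y \<Longrightarrow> g \<in> hom C Y Z \<Longrightarrow>
      AMap F (g \<cdot>\<^bsub>C\<^esub> f) = AMap F g \<cdot>\<^bsub>D\<^esub> AMap F f"

definition isomorphic_categories ::
    "('o, 'm, 'y) category_scheme \<Rightarrow> ('p, 'n, 'z) category_scheme \<Rightarrow> bool" where
  "isomorphic_categories C D \<longleftrightarrow>
    (\<exists>(F :: ('o, 'm, 'p, 'n) func) (G :: ('p, 'n, 'o, 'm) func).
      cat_functor C D F \<and> cat_functor D C G \<and>
      (\<forall>X \<in> Obj C. OMap G (OMap F X) = X) \<and> (\<forall>f \<in> Arr C. AMap G (AMap F f) = f) \<and>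
      (\<forall>X \<in> Obj D. OMap F (OMap G X) = X) \<and> (\<forall>f \<in> Arr D. AMap F (AMap G f) = f))"

text \<open>Binary coproducts are a chosen part of the structure, as the formulas below mention
  the injections; of the initial object only the existence is needed.\<close>

record ('o, 'm) coprod_category = "('o, 'm) category" +
  Coprod :: "'o \<Rightarrow> 'o \<Rightarrow> 'o" (infixr "\<amalg>\<index>" 65)
  Inl :: "'o \<Rightarrow> 'o \<Rightarrow> 'm"
  Inr :: "'o \<Rightarrow> 'o \<Rightarrow> 'm"

locale finite_coproduct_category = category C
  for C :: "('o, 'm, 'z) coprod_category_scheme" (structure) +
  assumes Coprod_in_Obj: "X \<in> Obj C \<Longrightarrow> Y \<in> Obj C \<Longrightarrow> X \<amalg> Y \<in> Obj C"
    and Inl_in_hom: "X \<in> Obj C \<Longrightarrow> Y \<in> Obj C \<Longrightarrow> Inl C X Y \<in> hom C X (X \<amalg> Y)"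
    and Inr_in_hom: "X \<in> Obj C \<Longrightarrow> Y \<in> Obj C \<Longrightarrow> Inr C X Y \<in> hom C Y (X \<amalg> Y)"
    and Coprod_universal: "f \<in> hom C X Z \<Longrightarrow> g \<in> hom C Y Z \<Longrightarrow>
      \<exists>!h. h \<in> hom C (X \<amalg> Y) Z \<and> h \<cdot> Inl C X Y = f \<and> h \<cdot> Inr C X Y = g"
    and initial_object: "\<exists>I \<in> Obj C. \<forall>X \<in> Obj C. \<exists>!f. f \<in> hom C I X"

definition copair :: "('o, 'm, 'z) coprod_category_scheme \<Rightarrow> 'm \<Rightarrow> 'm \<Rightarrow> 'm" where
  "copair C f g = (THE h. h \<in> hom C (Dom C f \<amalg>\<^bsub>C\<^esub> Dom C g) (Cod C f) \<and>
    h \<cdot>\<^bsub>C\<^esub> Inl C (Dom C f) (Dom C g) = f \<and> h \<cdot>\<^bsub>C\<^esub> Inr C (Dom C f) (Dom C g) = g)"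

definition coprod_map :: "('o, 'm, 'z) coprod_category_scheme \<Rightarrow> 'm \<Rightarrow> 'm \<Rightarrow> 'm" where
  "coprod_map C f g = copair C (Inl C (Cod C f) (Cod C g) \<cdot>\<^bsub>C\<^esub> f)
                               (Inr C (Cod C f) (Cod C g) \<cdot>\<^bsub>C\<^esub> g)"

definition coprod_assoc :: "('o, 'm, 'z) coprod_category_scheme \<Rightarrow> 'o \<Rightarrow> 'o \<Rightarrow> 'o \<Rightarrow> 'm" where
  \<comment> \<open>the canonical \<open>X \<amalg> (Y \<amalg> Z) \<rightarrow> (X \<amalg> Y) \<amalg> Z\<close>\<close>
  "coprod_assoc C X Y Z =
    copair C (Inl C (X \<amalg>\<^bsub>C\<^esub> Y) Z \<cdot>\<^bsub>C\<^esub> Inl C X Y)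
      (copair C (Inl C (X \<amalg>\<^bsub>C\<^esub> Y) Z \<cdot>\<^bsub>C\<^esub> Inr C X Y) (Inr C (X \<amalg>\<^bsub>C\<^esub> Y) Z))"

text \<open>The category with objects \<open>S\<close>, where \<open>a \<in> S\<close> has underlying object \<open>U a\<close> of \<open>C\<close>, and
  with morphisms \<open>a \<rightarrow> b\<close> those \<open>h : U a \<rightarrow> U b\<close> satisfying \<open>P a h b\<close>; identities and composition
  are those of \<open>C\<close>. A morphism is tagged with its source and target.\<close>

definition category_over :: "('o, 'm, 'z) category_scheme \<Rightarrow> 'a set \<Rightarrow> ('a \<Rightarrow> 'o) \<Rightarrow>
    ('a \<Rightarrow> 'm \<Rightarrow> 'a \<Rightarrow> bool) \<Rightarrow> ('a, 'a \<times> 'm \<times> 'a) category" where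
  "category_over C S U P =
    \<lparr>Obj = S,
     Arr = {(a, h, b). a \<in> S \<and> b \<in> S \<and> h \<in> hom C (U a) (U b) \<and> P a h b},
     Dom = (\<lambda>(a, h, b). a),
     Cod = (\<lambda>(a, h, b). b),
     Id = (\<lambda>a. (a, Id C (U a), a)),
     Comp = (\<lambda>(b', g, c) (a, f, b). (a, g \<cdot>\<^bsub>C\<^esub> f, c))\<rparr>"


section \<open>Iteratable endofunctors\<close>

definition final_coalgebra ::
    "('o, 'm, 'z) category_scheme \<Rightarrow> ('o, 'm, 'o, 'm) func \<Rightarrow> 'o \<Rightarrow> 'm \<Rightarrow> bool" where
  "final_coalgebra C F Z z \<longleftrightarrow> Z \<in> Obj C \<and> z \<in> hom C Z (OMap F Z) \<and>
    (\<forall>X \<in> Obj C. \<forall>c \<in> hom C X (OMap F X).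
      \<exists>!h. h \<in> hom C X Z \<and> z \<cdot>\<^bsub>C\<^esub> h = AMap F h \<cdot>\<^bsub>C\<^esub> c)"

definition plus_functor :: "('o, 'm, 'z) coprod_category_scheme \<Rightarrow> ('o, 'm, 'o, 'm) func \<Rightarrow> 'o \<Rightarrow>
    ('o, 'm, 'o, 'm) func" where
  \<comment> \<open>the functor \<open>H(-) + Y\<close>\<close>
  "plus_functor C H Y =
    \<lparr>OMap = (\<lambda>X. OMap H X \<amalg>\<^bsub>C\<^esub> Y), AMap = (\<lambda>f. coprod_map C (AMap H f) (Id C Y))\<rparr>"

definition iteratable ::
    "('o, 'm, 'z) coprod_category_scheme \<Rightarrow> ('o, 'm, 'o, 'm) func \<Rightarrow> bool" where
  "iteratable C H \<longleftrightarrow> (\<forall>Y \<in> Obj C. \<exists>Z z. final_coalgebra C (plus_functor C H Y) Z z)"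


section \<open>Flat equation morphisms and completely iterative algebras\<close>

definition is_algebra ::
    "('o, 'm, 'z) category_scheme \<Rightarrow> ('o, 'm, 'o, 'm) func \<Rightarrow> 'o \<Rightarrow> 'm \<Rightarrow> bool" where
  "is_algebra C H A \<alpha> \<longleftrightarrow> A \<in> Obj C \<and> \<alpha> \<in> hom C (OMap H A) A"

definition algebra_hom :: "('o, 'm, 'z) category_scheme \<Rightarrow> ('o, 'm, 'o, 'm) func \<Rightarrow>
    'o \<Rightarrow> 'm \<Rightarrow> 'o \<Rightarrow> 'm \<Rightarrow> 'm set" where
  "algebra_hom C H A \<alpha> B \<beta> = {h \<in> hom C A B. h \<cdot>\<^bsub>C\<^esub> \<alpha> = \<beta> \<cdot>\<^bsub>C\<^esub> AMap H h}"

text \<open>The object of variables of a flat equation morphism \<open>e : X \<rightarrow> H X + A\<close> is its domain.\<close>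

definition flat_eqs ::
    "('o, 'm, 'z) coprod_category_scheme \<Rightarrow> ('o, 'm, 'o, 'm) func \<Rightarrow> 'o \<Rightarrow> 'm set" where
  "flat_eqs C H A = (\<Union>X \<in> Obj C. hom C X (OMap H X \<amalg>\<^bsub>C\<^esub> A))"

definition is_solution :: "('o, 'm, 'z) coprod_category_scheme \<Rightarrow> ('o, 'm, 'o, 'm) func \<Rightarrow>
    'o \<Rightarrow> 'm \<Rightarrow> 'm \<Rightarrow> 'm \<Rightarrow> bool" where
  "is_solution C H A \<alpha> e s \<longleftrightarrow> s \<in> hom C (Dom C e) A \<and>
    s = copair C \<alpha> (Id C A) \<cdot>\<^bsub>C\<^esub> coprod_map C (AMap H s) (Id C A) \<cdot>\<^bsub>C\<^esub> e"

definition is_cia :: "('o, 'm, 'z) coprod_category_scheme \<Rightarrow> ('o, 'm, 'o, 'm) func \<Rightarrow>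
    'o \<Rightarrow> 'm \<Rightarrow> bool" where
  "is_cia C H A \<alpha> \<longleftrightarrow> is_algebra C H A \<alpha> \<and> (\<forall>e \<in> flat_eqs C H A. \<exists>!s. is_solution C H A \<alpha> e s)"


section \<open>The free completely iterative monad\<close>

definition is_free_cia :: "('o, 'm, 'z) coprod_category_scheme \<Rightarrow> ('o, 'm, 'o, 'm) func \<Rightarrow> 'o \<Rightarrow>
    'o \<times> 'm \<times> 'm \<Rightarrow> bool" where
  "is_free_cia C H Y = (\<lambda>(T, \<tau>, \<eta>). is_cia C H T \<tau> \<and> \<eta> \<in> hom C Y T \<and>
    (\<forall>A \<alpha> f. is_cia C H A \<alpha> \<longrightarrow> f \<in> hom C Y A \<longrightarrow>
      (\<exists>!h. h \<in> algebra_hom C H T \<tau> A \<alpha> \<and> h \<cdot>\<^bsub>C\<^esub> \<eta> = f)))"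

text \<open>A free completely iterative algebra is unique up to isomorphism; the components of the
  chosen one are its carrier, its algebra structure and its universal arrow.\<close>

definition free_cia :: "('o, 'm, 'z) coprod_category_scheme \<Rightarrow> ('o, 'm, 'o, 'm) func \<Rightarrow> 'o \<Rightarrow>
    'o \<times> 'm \<times> 'm" where
  "free_cia C H Y = (SOME F. is_free_cia C H Y F)"

definition cia_carrier where "cia_carrier C H Y = fst (free_cia C H Y)"
definition cia_struct where "cia_struct C H Y = fst (snd (free_cia C H Y))"
definition cia_unit where "cia_unit C H Y = snd (snd (free_cia C H Y))"

definition cia_ext :: "('o, 'm, 'z) coprod_category_scheme \<Rightarrow> ('o, 'm, 'o, 'm) func \<Rightarrow> 'o \<Rightarrow>
    'o \<Rightarrow> 'm \<Rightarrow> 'm \<Rightarrow> 'm" where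
  \<comment> \<open>the unique homomorphism from the free algebra on \<open>Y\<close> to \<open>(A, \<alpha>)\<close> extending \<open>f : Y \<rightarrow> A\<close>\<close>
  "cia_ext C H Y A \<alpha> f =
    (THE h. h \<in> algebra_hom C H (cia_carrier C H Y) (cia_struct C H Y) A \<alpha> \<and>
      h \<cdot>\<^bsub>C\<^esub> cia_unit C H Y = f)"

record ('o, 'm) monad =
  Fun :: "('o, 'm, 'o, 'm) func"
  Unit :: "'o \<Rightarrow> 'm"
  Mult :: "'o \<Rightarrow> 'm"

text \<open>The monad of the adjunction given by the universal arrows \<open>\<eta>\<^sub>Y : Y \<rightarrow> T Y\<close>: the morphism \<open>T f\<close>
  extends \<open>\<eta> \<cdot> f\<close>, and \<open>\<mu>\<^sub>Y\<close> is the counit at \<open>T Y\<close>, i.e. it extends the identity of \<open>T Y\<close>.\<close>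

definition free_ci_monad :: "('o, 'm, 'z) coprod_category_scheme \<Rightarrow> ('o, 'm, 'o, 'm) func \<Rightarrow>
    ('o, 'm) monad" where
  "free_ci_monad C H =
    \<lparr>Fun = \<lparr>OMap = cia_carrier C H,
            AMap = (\<lambda>f. cia_ext C H (Dom C f) (cia_carrier C H (Cod C f)) (cia_struct C H (Cod C f))
                          (cia_unit C H (Cod C f) \<cdot>\<^bsub>C\<^esub> f))\<rparr>,
     Unit = cia_unit C H,
     Mult = (\<lambda>Y. cia_ext C H (cia_carrier C H Y) (cia_carrier C H Y) (cia_struct C H Y)
                   (Id C (cia_carrier C H Y)))\<rparr>"

definition eilenberg_moore :: "('o, 'm, 'z) category_scheme \<Rightarrow> ('o, 'm) monad \<Rightarrow>
    ('o \<times> 'm, ('o \<times> 'm) \<times> 'm \<times> ('o \<times> 'm)) category" where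
  "eilenberg_moore C M =
    category_over C
      {(A, a). A \<in> Obj C \<and> a \<in> hom C (OMap (Fun M) A) A \<and>
        a \<cdot>\<^bsub>C\<^esub> Unit M A = Id C A \<and> a \<cdot>\<^bsub>C\<^esub> Mult M A = a \<cdot>\<^bsub>C\<^esub> AMap (Fun M) a}
      fst
      (\<lambda>(A, a) h (B, b). h \<cdot>\<^bsub>C\<^esub> a = b \<cdot>\<^bsub>C\<^esub> AMap (Fun M) h)"


section \<open>Complete Elgot algebras\<close>

definition rename_params :: "('o, 'm, 'z) coprod_category_scheme \<Rightarrow> ('o, 'm, 'o, 'm) func \<Rightarrow>
    'm \<Rightarrow> 'm \<Rightarrow> 'm" where
  \<comment> \<open>\<open>h \<bullet> e\<close>\<close>
  "rename_params C H h e = coprod_map C (Id C (OMap H (Dom C e))) h \<cdot>\<^bsub>C\<^esub> e"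

definition can :: "('o, 'm, 'z) coprod_category_scheme \<Rightarrow> ('o, 'm, 'o, 'm) func \<Rightarrow> 'o \<Rightarrow> 'o \<Rightarrow> 'm" where
  "can C H X Y = copair C (AMap H (Inl C X Y)) (AMap H (Inr C X Y))"

text \<open>For \<open>e : X \<rightarrow> H X + Y\<close> and \<open>f : Y \<rightarrow> H Y + A\<close>, the equation \<open>f \<oplus> e : X + Y \<rightarrow> H (X + Y) + A\<close>;
  the associativity isomorphism is usually left implicit.\<close>

definition plus_eq :: "('o, 'm, 'z) coprod_category_scheme \<Rightarrow> ('o, 'm, 'o, 'm) func \<Rightarrow>
    'o \<Rightarrow> 'm \<Rightarrow> 'm \<Rightarrow> 'm" where
  "plus_eq C H A f e = (let X = Dom C e; Y = Dom C f in
    coprod_map C (can C H X Y) (Id C A) \<cdot>\<^bsub>C\<^esub>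
    coprod_assoc C (OMap H X) (OMap H Y) A \<cdot>\<^bsub>C\<^esub>
    coprod_map C (Id C (OMap H X)) f \<cdot>\<^bsub>C\<^esub>
    copair C e (Inr C (OMap H X) Y))"

text \<open>The assignment \<open>sol\<close> is made extensional outside the flat equation morphisms in \<open>A\<close>, so that
  complete Elgot algebras are equal iff they have the same solutions.\<close>

definition complete_elgot_algebra :: "('o, 'm, 'z) coprod_category_scheme \<Rightarrow>
    ('o, 'm, 'o, 'm) func \<Rightarrow> 'o \<Rightarrow> 'm \<Rightarrow> ('m \<Rightarrow> 'm) \<Rightarrow> bool" where
  "complete_elgot_algebra C H A \<alpha> sol \<longleftrightarrow>
    is_algebra C H A \<alpha> \<and>
    sol \<in> extensional (flat_eqs C H A) \<and>
    (\<forall>e \<in> flat_eqs C H A. is_solution C H A \<alpha> e (sol e)) \<and>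
    (\<forall>X \<in> Obj C. \<forall>Y \<in> Obj C.
      \<forall>e \<in> hom C X (OMap H X \<amalg>\<^bsub>C\<^esub> A). \<forall>f \<in> hom C Y (OMap H Y \<amalg>\<^bsub>C\<^esub> A). \<forall>h \<in> hom C X Y.
      coprod_map C (AMap H h) (Id C A) \<cdot>\<^bsub>C\<^esub> e = f \<cdot>\<^bsub>C\<^esub> h \<longrightarrow> sol e = sol f \<cdot>\<^bsub>C\<^esub> h) \<and>
    (\<forall>X \<in> Obj C. \<forall>Y \<in> Obj C.
      \<forall>e \<in> hom C X (OMap H X \<amalg>\<^bsub>C\<^esub> Y). \<forall>f \<in> hom C Y (OMap H Y \<amalg>\<^bsub>C\<^esub> A).
      sol (rename_params C H (sol f) e) = sol (plus_eq C H A f e) \<cdot>\<^bsub>C\<^esub> Inl C X Y)"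

definition solution_preserving :: "('o, 'm, 'z) coprod_category_scheme \<Rightarrow>
    ('o, 'm, 'o, 'm) func \<Rightarrow> 'o \<Rightarrow> ('m \<Rightarrow> 'm) \<Rightarrow> ('m \<Rightarrow> 'm) \<Rightarrow> 'm \<Rightarrow> bool" where
  "solution_preserving C H A solA solB h \<longleftrightarrow>
    (\<forall>e \<in> flat_eqs C H A. h \<cdot>\<^bsub>C\<^esub> solA e = solB (rename_params C H h e))"

definition CElgot :: "('o, 'm, 'z) coprod_category_scheme \<Rightarrow> ('o, 'm, 'o, 'm) func \<Rightarrow>
    ('o \<times> 'm \<times> ('m \<Rightarrow> 'm), ('o \<times> 'm \<times> ('m \<Rightarrow> 'm)) \<times> 'm \<times> ('o \<times> 'm \<times> ('m \<Rightarrow> 'm))) category" where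
  "CElgot C H =
    category_over C
      {(A, \<alpha>, sol). complete_elgot_algebra C H A \<alpha> sol}
      fst
      (\<lambda>(A, \<alpha>, solA) h (B, \<beta>, solB). solution_preserving C H A solA solB h)"

end

theory Submission
  imports Defs
begin

text \<open>
  Write \<open>out : T A \<rightarrow> H T A + A\<close> for the inverse of \<open>[\<tau>, \<eta>]\<close>; it exists because a final coalgebra of
  \<open>H(-) + A\<close> is a free completely iterative algebra on \<open>A\<close>. No monadicity theorem is needed:
  a complete Elgot algebra corresponds to \<open>a = out\<^sup>\<dagger> : T A \<rightarrow> A\<close>. Every \<open>e : X \<rightarrow> H X + A\<close> has a unique
  solution \<open>e* : X \<rightarrow> T A\<close> of \<open>\<eta> \<bullet> e\<close>, which is an equation morphism from \<open>e\<close> to \<open>out\<close>, so functoriality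
  gives \<open>e\<^sup>\<dagger> = a \<cdot> e*\<close> and \<open>(f \<bullet> out)\<^sup>\<dagger> = a \<cdot> T f\<close>. Compositionality for \<open>out\<close> on \<open>T A\<close> and on \<open>A\<close>
  becomes \<open>a \<cdot> T a = a \<cdot> \<mu>\<close>. Conversely, an Eilenberg--Moore algebra \<open>a\<close> has the algebra structure
  \<open>a \<cdot> \<tau> \<cdot> H \<eta>\<close> and the solutions \<open>a \<cdot> e*\<close>, whose laws are inherited from those of the unique solutions in
  the free completely iterative algebras.
\<close>

section \<open>Domains, codomains and rewriting of composites\<close>

lemma hom_iff: "f \<in> hom C X Y \<longleftrightarrow> f \<in> Arr C \<and> Dom C f = X \<and> Cod C f = Y"
  by (simp add: hom_def)

lemma homE:
  assumes "f \<in> hom C X Y"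
  shows "f \<in> Arr C" "Dom C f = X" "Cod C f = Y"
  using assms by (auto simp: hom_def)

context category
begin

declare Dom_in_Obj [simp] Cod_in_Obj [simp]

lemma hom_Obj:
  assumes "f \<in> hom C X Y"
  shows "X \<in> Obj C" "Y \<in> Obj C"
  using assms by (auto simp: hom_def)

lemma Id_simps [simp]:
  assumes "X \<in> Obj C"
  shows "Id C X \<in> Arr C" "Dom C (Id C X) = X" "Cod C (Id C X) = X"
  using Id_in_hom[OF assms] by (auto simp: hom_def)

lemma Comp_simps [simp]:
  assumes "f \<in> Arr C" "g \<in> Arr C" "Dom C g = Cod C f"
  shows "g \<cdot> f \<in> Arr C" "Dom C (g \<cdot> f) = Dom C f" "Cod C (g \<cdot> f) = Cod C g"
  using Comp_in_hom[of f "Dom C f" "Cod C f" g "Cod C g"] assms by (auto simp: hom_def)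

lemma Comp_Id_simp [simp]: "f \<in> Arr C \<Longrightarrow> Dom C f = X \<Longrightarrow> f \<cdot> Id C X = f"
  by (rule Comp_Id) (simp add: hom_def)

lemma Id_Comp_simp [simp]: "f \<in> Arr C \<Longrightarrow> Cod C f = X \<Longrightarrow> Id C X \<cdot> f = f"
  by (rule Id_Comp) (simp add: hom_def)

lemma Comp_assoc_simp [simp]:
  "f \<in> Arr C \<Longrightarrow> g \<in> Arr C \<Longrightarrow> h \<in> Arr C \<Longrightarrow> Dom C g = Cod C f \<Longrightarrow> Dom C h = Cod C g \<Longrightarrow>
    (h \<cdot> g) \<cdot> f = h \<cdot> g \<cdot> f"
  by (rule Comp_assoc) (auto simp: hom_def)

text \<open>\<open>Comp_assoc_simp\<close> nests composites to the right, where an equation about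
  \<open>g \<cdot> f\<close> no longer matches once \<open>k\<close> precedes \<open>f\<close>; this
  supplies the version that does.\<close>

lemma Comp_reassoc:
  "g \<cdot> f = h \<Longrightarrow> k \<in> Arr C \<Longrightarrow> f \<in> Arr C \<Longrightarrow> g \<in> Arr C \<Longrightarrow> Dom C f = Cod C k \<Longrightarrow> Dom C g = Cod C f \<Longrightarrow>
    g \<cdot> f \<cdot> k = h \<cdot> k"
  using Comp_assoc_simp[of k f g] by simp

end

context cat_functor
begin

lemma AMap_simps [simp]:
  assumes "f \<in> Arr C"
  shows "AMap F f \<in> Arr D" "Dom D (AMap F f) = OMap F (Dom C f)" "Cod D (AMap F f) = OMap F (Cod C f)"
  using AMap_in_hom[of f "Dom C f" "Cod C f"] assms by (auto simp: hom_def)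

lemma AMap_Comp_simp [simp]:
  "f \<in> Arr C \<Longrightarrow> g \<in> Arr C \<Longrightarrow> Dom C g = Cod C f \<Longrightarrow> AMap F (g \<cdot>\<^bsub>C\<^esub> f) = AMap F g \<cdot>\<^bsub>D\<^esub> AMap F f"
  by (rule AMap_Comp) (auto simp: hom_def)

declare OMap_in_Obj [simp] AMap_Id [simp]

end


section \<open>Categories over a base category\<close>

lemma category_over_category:
  assumes "category C"
    and U: "\<And>a. a \<in> S \<Longrightarrow> U a \<in> Obj C"
    and Id: "\<And>a. a \<in> S \<Longrightarrow> P a (Id C (U a)) a"
    and Comp: "\<And>a b c f g. a \<in> S \<Longrightarrow> b \<in> S \<Longrightarrow> c \<in> S \<Longrightarrow> f \<in> hom C (U a) (U b) \<Longrightarrow>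
      g \<in> hom C (U b) (U c) \<Longrightarrow> P a f b \<Longrightarrow> P b g c \<Longrightarrow> P a (g \<cdot>\<^bsub>C\<^esub> f) c"
  shows "category (category_over C S U P)"
proof -
  interpret category C by fact
  show ?thesis
    by unfold_locales
      (auto simp: category_over_def hom_iff U Id intro: Comp)
qed

text \<open>Arrows on both sides are arrows of \<open>C\<close> tagged with endpoints, so an object
  bijection that respects underlying objects and the predicates only has to relabel the tags.
  Closure under identities and composition is assumed for the primed side and carried over by
  \<open>P\<close>.\<close>

lemma isomorphic_category_over:
  fixes F :: "'a \<Rightarrow> 'b" and G :: "'b \<Rightarrow> 'a"
  assumes C: "category C"
    and U: "\<And>b. b \<in> S' \<Longrightarrow> U' b \<in> Obj C"
    and Id: "\<And>b. b \<in> S' \<Longrightarrow> P' b (Id C (U' b)) b"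
    and Comp: "\<And>a b c f g. a \<in> S' \<Longrightarrow> b \<in> S' \<Longrightarrow> c \<in> S' \<Longrightarrow> f \<in> hom C (U' a) (U' b) \<Longrightarrow>
      g \<in> hom C (U' b) (U' c) \<Longrightarrow> P' a f b \<Longrightarrow> P' b g c \<Longrightarrow> P' a (g \<cdot>\<^bsub>C\<^esub> f) c"
    and F: "\<And>a. a \<in> S \<Longrightarrow> F a \<in> S'" "\<And>a. a \<in> S \<Longrightarrow> U' (F a) = U a" "\<And>a. a \<in> S \<Longrightarrow> G (F a) = a"
    and G: "\<And>b. b \<in> S' \<Longrightarrow> G b \<in> S" "\<And>b. b \<in> S' \<Longrightarrow> F (G b) = b"
    and P: "\<And>a b h. a \<in> S \<Longrightarrow> b \<in> S \<Longrightarrow> h \<in> hom C (U a) (U b) \<Longrightarrow> P a h b \<longleftrightarrow> P' (F a) h (F b)"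
  shows "isomorphic_categories (category_over C S U P) (category_over C S' U' P')"
proof -
  interpret category C by fact
  let ?D = "category_over C S U P" and ?D' = "category_over C S' U' P'"
  have UG: "U (G b) = U' b" if "b \<in> S'" for b
    using F(2)[of "G b"] G that by simp
  have P': "P (G a) h (G b) \<longleftrightarrow> P' a h b" if "a \<in> S'" "b \<in> S'" "h \<in> hom C (U' a) (U' b)" for a h b
    using P[of "G a" "G b" h] that by (simp add: G UG)
  have UO: "U a \<in> Obj C" if "a \<in> S" for a
    using U[of "F a"] F that by simp
  have D': "category ?D'"
    by (rule category_over_category[where S = S' and U = U' and P = P', OF C U Id]) (auto intro: Comp)
  have D: "category ?D"
  proof (rule category_over_category[where S = S and U = U and P = P, OF C UO])
    show "P a (Id C (U a)) a" if "a \<in> S" for a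
      using Id[of "F a"] F[of a] P[of a a "Id C (U a)"] that Id_in_hom[OF UO[OF that]] by simp
    show "P a (g \<cdot>\<^bsub>C\<^esub> f) c"
      if *: "a \<in> S" "b \<in> S" "c \<in> S" "f \<in> hom C (U a) (U b)" "g \<in> hom C (U b) (U c)"
        "P a f b" "P b g c" for a b c f g
      using Comp[of "F a" "F b" "F c" f g] Comp_in_hom[OF *(4,5)] * by (simp add: F P)
  qed
  interpret D: category ?D by fact
  interpret D': category ?D' by fact
  let ?F = "\<lparr>OMap = F, AMap = (\<lambda>(a, h, b). (F a, h, F b))\<rparr>"
  let ?G = "\<lparr>OMap = G, AMap = (\<lambda>(a, h, b). (G a, h, G b))\<rparr>"
  have "cat_functor ?D ?D' ?F"
    by unfold_locales (auto simp: category_over_def hom_iff F P)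
  moreover have "cat_functor ?D' ?D ?G"
    by unfold_locales (auto simp: category_over_def hom_iff G UG P')
  ultimately show ?thesis
    unfolding isomorphic_categories_def
    by (intro exI[of _ ?F] exI[of _ ?G]) (auto simp: category_over_def F G)
qed


section \<open>Calculating with coproducts\<close>

context finite_coproduct_category
begin

declare Coprod_in_Obj [simp]

lemma Inl_simps [simp]:
  assumes "X \<in> Obj C" "Y \<in> Obj C"
  shows "Inl C X Y \<in> Arr C" "Dom C (Inl C X Y) = X" "Cod C (Inl C X Y) = X \<amalg> Y"
  using Inl_in_hom[OF assms] by (auto simp: hom_def)

lemma Inr_simps [simp]:
  assumes "X \<in> Obj C" "Y \<in> Obj C"
  shows "Inr C X Y \<in> Arr C" "Dom C (Inr C X Y) = Y" "Cod C (Inr C X Y) = X \<amalg> Y"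
  using Inr_in_hom[OF assms] by (auto simp: hom_def)

lemma copair_aux:
  assumes "f \<in> Arr C" "g \<in> Arr C" "Cod C g = Cod C f"
  shows "copair C f g \<in> hom C (Dom C f \<amalg> Dom C g) (Cod C f) \<and>
    copair C f g \<cdot> Inl C (Dom C f) (Dom C g) = f \<and> copair C f g \<cdot> Inr C (Dom C f) (Dom C g) = g"
  unfolding copair_def
  by (rule theI', rule Coprod_universal) (use assms in \<open>auto simp: hom_def\<close>)

lemma copair_simps [simp]:
  assumes "f \<in> Arr C" "g \<in> Arr C" "Cod C g = Cod C f"
  shows "copair C f g \<in> Arr C" "Dom C (copair C f g) = Dom C f \<amalg> Dom C g"
    "Cod C (copair C f g) = Cod C f"
  using copair_aux[OF assms] by (auto simp: hom_def)

lemma copair_Inl [simp]: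
  "f \<in> Arr C \<Longrightarrow> g \<in> Arr C \<Longrightarrow> Cod C g = Cod C f \<Longrightarrow> Dom C f = X \<Longrightarrow> Dom C g = Y \<Longrightarrow>
    copair C f g \<cdot> Inl C X Y = f"
  using copair_aux by blast

lemma copair_Inr [simp]:
  "f \<in> Arr C \<Longrightarrow> g \<in> Arr C \<Longrightarrow> Cod C g = Cod C f \<Longrightarrow> Dom C f = X \<Longrightarrow> Dom C g = Y \<Longrightarrow>
    copair C f g \<cdot> Inr C X Y = g"
  using copair_aux by blast

lemma copair_Inl_Comp [simp]:
  "f \<in> Arr C \<Longrightarrow> g \<in> Arr C \<Longrightarrow> Cod C g = Cod C f \<Longrightarrow> Dom C f = X \<Longrightarrow> Dom C g = Y \<Longrightarrow>
    k \<in> Arr C \<Longrightarrow> Cod C k = X \<Longrightarrow> copair C f g \<cdot> Inl C X Y \<cdot> k = f \<cdot> k"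
  using Comp_assoc_simp[of k "Inl C X Y" "copair C f g"] by auto

lemma copair_Inr_Comp [simp]:
  "f \<in> Arr C \<Longrightarrow> g \<in> Arr C \<Longrightarrow> Cod C g = Cod C f \<Longrightarrow> Dom C f = X \<Longrightarrow> Dom C g = Y \<Longrightarrow>
    k \<in> Arr C \<Longrightarrow> Cod C k = Y \<Longrightarrow> copair C f g \<cdot> Inr C X Y \<cdot> k = g \<cdot> k"
  using Comp_assoc_simp[of k "Inr C X Y" "copair C f g"] by auto

lemma Coprod_eqI:
  assumes "h \<in> hom C (X \<amalg> Y) Z" "k \<in> hom C (X \<amalg> Y) Z" "X \<in> Obj C" "Y \<in> Obj C"
    and "h \<cdot> Inl C X Y = k \<cdot> Inl C X Y" "h \<cdot> Inr C X Y = k \<cdot> Inr C X Y"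
  shows "h = k"
  using Coprod_universal[of "k \<cdot> Inl C X Y" X Z "k \<cdot> Inr C X Y" Y] assms
  by (auto simp: hom_def)

lemma copair_eqI:
  assumes "h \<in> Arr C" "Dom C h = Dom C f \<amalg> Dom C g" "Cod C h = Cod C f"
    "f \<in> Arr C" "g \<in> Arr C" "Cod C g = Cod C f"
    and "h \<cdot> Inl C (Dom C f) (Dom C g) = f" "h \<cdot> Inr C (Dom C f) (Dom C g) = g"
  shows "h = copair C f g"
  by (rule Coprod_eqI[of _ "Dom C f" "Dom C g" "Cod C f"]) (use assms in \<open>auto simp: hom_def\<close>)

text \<open>Oriented so that postcomposition moves into the copair; equalities of such composites
  then reduce to equalities of components.\<close>

lemma Comp_copair [simp]:
  "f \<in> Arr C \<Longrightarrow> g \<in> Arr C \<Longrightarrow> Cod C g = Cod C f \<Longrightarrow> h \<in> Arr C \<Longrightarrow> Dom C h = Cod C f \<Longrightarrow>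
    h \<cdot> copair C f g = copair C (h \<cdot> f) (h \<cdot> g)"
  by (rule copair_eqI) auto

lemma Comp_copair_Comp [simp]:
  "f \<in> Arr C \<Longrightarrow> g \<in> Arr C \<Longrightarrow> Cod C g = Cod C f \<Longrightarrow> h \<in> Arr C \<Longrightarrow> Dom C h = Cod C f \<Longrightarrow>
    k \<in> Arr C \<Longrightarrow> Cod C k = Dom C f \<amalg> Dom C g \<Longrightarrow>
    h \<cdot> copair C f g \<cdot> k = copair C (h \<cdot> f) (h \<cdot> g) \<cdot> k"
  using Comp_assoc_simp[of k "copair C f g" h] by auto

lemma copair_Inl_Inr [simp]:
  "X \<in> Obj C \<Longrightarrow> Y \<in> Obj C \<Longrightarrow> copair C (Inl C X Y) (Inr C X Y) = Id C (X \<amalg> Y)"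
  by (rule copair_eqI[symmetric]) auto

end


section \<open>Flat equations in normal form\<close>

locale coprod_endofunctor = finite_coproduct_category C + H: cat_functor C C H
  for C :: "('o, 'm, 'z) coprod_category_scheme" (structure) and H :: "('o, 'm, 'o, 'm) func"
begin

lemma AMap_copair_Inl [simp]:
  "f \<in> Arr C \<Longrightarrow> g \<in> Arr C \<Longrightarrow> Cod C g = Cod C f \<Longrightarrow> Dom C f = X \<Longrightarrow> Dom C g = Y \<Longrightarrow>
    AMap H (copair C f g) \<cdot> AMap H (Inl C X Y) = AMap H f"
  using H.AMap_Comp_simp[of "Inl C X Y" "copair C f g"] by auto

lemma AMap_copair_Inr [simp]:
  "f \<in> Arr C \<Longrightarrow> g \<in> Arr C \<Longrightarrow> Cod C g = Cod C f \<Longrightarrow> Dom C f = X \<Longrightarrow> Dom C g = Y \<Longrightarrow>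
    AMap H (copair C f g) \<cdot> AMap H (Inr C X Y) = AMap H g"
  using H.AMap_Comp_simp[of "Inr C X Y" "copair C f g"] by auto

lemma flat_eqsI: "e \<in> hom C X (OMap H X \<amalg> A) \<Longrightarrow> e \<in> flat_eqs C H A"
  using hom_Obj unfolding flat_eqs_def by blast

lemma flat_eqsE:
  assumes "e \<in> flat_eqs C H A"
  obtains X where "X \<in> Obj C" "e \<in> hom C X (OMap H X \<amalg> A)"
  using assms unfolding flat_eqs_def by blast

text \<open>Fuses \<open>[\<alpha>, id]\<close> with \<open>H s + id\<close> into
  \<open>[\<alpha> \<cdot> H s, id]\<close>, the form in which solutions are computed from here
  on.\<close>

lemma is_solution_iff:
  assumes "is_algebra C H A \<alpha>" "e \<in> hom C X (OMap H X \<amalg> A)"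
  shows "is_solution C H A \<alpha> e s \<longleftrightarrow>
    s \<in> hom C X A \<and> copair C (\<alpha> \<cdot> AMap H s) (Id C A) \<cdot> e = s"
  using assms hom_Obj[OF assms(2)]
  by (auto simp: is_solution_def is_algebra_def hom_def coprod_map_def)

lemma rename_params_eq:
  assumes "e \<in> hom C X (OMap H X \<amalg> Y)" "h \<in> hom C Y Z" "Y \<in> Obj C"
  shows "rename_params C H h e =
    copair C (Inl C (OMap H X) Z) (Inr C (OMap H X) Z \<cdot> h) \<cdot> e"
  using homE[OF assms(1)] homE[OF assms(2)] hom_Obj[OF assms(1)] hom_Obj[OF assms(2)]
  by (simp add: rename_params_def coprod_map_def)

lemma rename_params_in_hom:
  assumes "e \<in> hom C X (OMap H X \<amalg> Y)" "h \<in> hom C Y Z" "Y \<in> Obj C"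
  shows "rename_params C H h e \<in> hom C X (OMap H X \<amalg> Z)"
  using homE[OF assms(1)] homE[OF assms(2)] hom_Obj[OF assms(1)] hom_Obj[OF assms(2)]
  by (simp add: rename_params_eq[OF assms] hom_iff)

lemma rename_params_Id:
  assumes "e \<in> hom C X (OMap H X \<amalg> Y)" "Y \<in> Obj C"
  shows "rename_params C H (Id C Y) e = e"
  using assms hom_Obj[OF assms(1)]
  by (simp add: rename_params_eq[OF assms(1) Id_in_hom] hom_def)

text \<open>Evaluating \<open>can\<close> and the associativity isomorphism leaves a copair:
  \<open>r\<close> is \<open>f\<close> with its variables moved along \<open>inr\<close>; on
  \<open>X\<close>, the variables of \<open>e\<close> are moved along \<open>inl\<close> and its
  parameters in \<open>Y\<close> are replaced by \<open>r\<close>.\<close>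

lemma plus_eq_eq:
  assumes "e \<in> hom C X (OMap H X \<amalg> Y)" "f \<in> hom C Y (OMap H Y \<amalg> A)" "A \<in> Obj C"
  defines "r \<equiv> copair C (Inl C (OMap H (X \<amalg> Y)) A \<cdot> AMap H (Inr C X Y)) (Inr C (OMap H (X \<amalg> Y)) A) \<cdot> f"
  shows "plus_eq C H A f e =
    copair C (copair C (Inl C (OMap H (X \<amalg> Y)) A \<cdot> AMap H (Inl C X Y)) r \<cdot> e) r"
  using homE[OF assms(1)] homE[OF assms(2)] assms(3) hom_Obj[OF assms(1)] hom_Obj[OF assms(2)]
  by (simp add: plus_eq_def r_def coprod_map_def coprod_assoc_def can_def Let_def)

lemma plus_eq_in_hom:
  assumes "e \<in> hom C X (OMap H X \<amalg> Y)" "f \<in> hom C Y (OMap H Y \<amalg> A)" "A \<in> Obj C"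
  shows "plus_eq C H A f e \<in> hom C (X \<amalg> Y) (OMap H (X \<amalg> Y) \<amalg> A)"
  using homE[OF assms(1)] homE[OF assms(2)] assms(3) hom_Obj[OF assms(1)] hom_Obj[OF assms(2)]
  by (simp add: plus_eq_eq[OF assms] hom_iff)

end

section \<open>Final coalgebras and free completely iterative algebras\<close>

context coprod_endofunctor
begin

lemma final_coalgebra_plus:
  assumes "final_coalgebra C (plus_functor C H Y) Z z" "Y \<in> Obj C"
  shows "Z \<in> Obj C" "z \<in> hom C Z (OMap H Z \<amalg> Y)"
    and "c \<in> hom C X (OMap H X \<amalg> Y) \<Longrightarrow>
      \<exists>!h. h \<in> hom C X Z \<and> z \<cdot> h = copair C (Inl C (OMap H Z) Y \<cdot> AMap H h) (Inr C (OMap H Z) Y) \<cdot> c"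
proof -
  show Z: "Z \<in> Obj C" and "z \<in> hom C Z (OMap H Z \<amalg> Y)"
    using assms by (auto simp: final_coalgebra_def plus_functor_def)
  show "\<exists>!h. h \<in> hom C X Z \<and> z \<cdot> h = copair C (Inl C (OMap H Z) Y \<cdot> AMap H h) (Inr C (OMap H Z) Y) \<cdot> c"
    if c: "c \<in> hom C X (OMap H X \<amalg> Y)"
  proof -
    have "coprod_map C (AMap H h) (Id C Y) = copair C (Inl C (OMap H Z) Y \<cdot> AMap H h) (Inr C (OMap H Z) Y)"
      if "h \<in> hom C X Z" for h
      using that assms(2) Z by (simp add: coprod_map_def hom_def)
    then have eq: "h \<in> hom C X Z \<and> z \<cdot> h = copair C (Inl C (OMap H Z) Y \<cdot> AMap H h) (Inr C (OMap H Z) Y) \<cdot> c \<longleftrightarrow>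
        h \<in> hom C X Z \<and> z \<cdot> h = coprod_map C (AMap H h) (Id C Y) \<cdot> c" for h
      by auto
    have "\<exists>!h. h \<in> hom C X Z \<and> z \<cdot> h = coprod_map C (AMap H h) (Id C Y) \<cdot> c"
      using assms c hom_Obj[OF c] by (auto simp: final_coalgebra_def plus_functor_def)
    then show ?thesis
      unfolding eq .
  qed
qed

text \<open>Both \<open>h\<close> and the identity are coalgebra morphisms from \<open>z\<close> to
  itself. This serves to invert \<open>z\<close> and, later, to identify the \<open>Z\<close>
  component of coalgebra morphisms out of \<open>X + Z\<close>.\<close>

lemma final_coalgebra_endo:
  assumes "final_coalgebra C (plus_functor C H Y) Z z" "Y \<in> Obj C"
    and "h \<in> hom C Z Z" "z \<cdot> h = copair C (Inl C (OMap H Z) Y \<cdot> AMap H h) (Inr C (OMap H Z) Y) \<cdot> z"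
  shows "h = Id C Z"
proof -
  note z = final_coalgebra_plus(1,2)[OF assms(1,2)]
  have "Id C Z \<in> hom C Z Z \<and>
      z \<cdot> Id C Z = copair C (Inl C (OMap H Z) Y \<cdot> AMap H (Id C Z)) (Inr C (OMap H Z) Y) \<cdot> z"
    using z(1) homE[OF z(2)] assms(2) by (simp add: hom_iff)
  then show ?thesis
    using final_coalgebra_plus(3)[OF assms(1,2) z(2)] assms(3,4) by blast
qed

text \<open>This is Lambek's lemma. The inverse of \<open>z\<close> is delivered in its two
  components, an algebra structure and a unit.\<close>

lemma final_coalgebra_inverse:
  assumes "final_coalgebra C (plus_functor C H Y) Z z" "Y \<in> Obj C"
  obtains \<tau> \<eta> where "\<tau> \<in> hom C (OMap H Z) Z" "\<eta> \<in> hom C Y Z"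
    "z \<cdot> \<tau> = Inl C (OMap H Z) Y" "z \<cdot> \<eta> = Inr C (OMap H Z) Y" "copair C \<tau> \<eta> \<cdot> z = Id C Z"
proof -
  note fin = final_coalgebra_plus[OF assms]
  note [simp] = fin(1) homE[OF fin(2)] assms(2)
  let ?i = "Inl C (OMap H Z) Y" and ?j = "Inr C (OMap H Z) Y"
  let ?K = "OMap H Z \<amalg> Y"
  \<comment> \<open>\<open>H z + id\<close> makes \<open>?K\<close> a coalgebra, and
    \<open>w\<close> will be its morphism into the final one.\<close>
  have "copair C (Inl C (OMap H ?K) Y \<cdot> AMap H z) (Inr C (OMap H ?K) Y) \<in> hom C ?K (OMap H ?K \<amalg> Y)"
    by (simp add: hom_def)
  from fin(3)[OF this] obtain w where w: "w \<in> hom C ?K Z"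
    and zw: "z \<cdot> w = copair C (?i \<cdot> AMap H w) ?j \<cdot> copair C (Inl C (OMap H ?K) Y \<cdot> AMap H z) (Inr C (OMap H ?K) Y)"
    by blast
  note [simp] = homE[OF w]
  from zw have zw: "z \<cdot> w = copair C (?i \<cdot> AMap H (w \<cdot> z)) ?j"
    by simp
  \<comment> \<open>\<open>w \<cdot> z\<close> is a coalgebra endomorphism of \<open>z\<close>,
    hence the identity; inserted into the equation for \<open>z \<cdot> w\<close>, this yields the
    other inverse law.\<close>
  have "z \<cdot> w \<cdot> z = (z \<cdot> w) \<cdot> z"
    by simp
  also have "\<dots> = copair C (?i \<cdot> AMap H (w \<cdot> z)) ?j \<cdot> z"
    by (simp only: zw)
  finally have wz: "w \<cdot> z = Id C Z"
    by (intro final_coalgebra_endo[OF assms]) (auto simp: hom_def)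
  have zw: "z \<cdot> w = Id C ?K"
    unfolding zw wz by simp
  show ?thesis
  proof (rule that[of "w \<cdot> ?i" "w \<cdot> ?j"])
    show "z \<cdot> w \<cdot> ?i = ?i" "z \<cdot> w \<cdot> ?j = ?j"
      using arg_cong[OF zw, of "\<lambda>u. u \<cdot> ?i"] arg_cong[OF zw, of "\<lambda>u. u \<cdot> ?j"] by auto
    have "copair C (w \<cdot> ?i) (w \<cdot> ?j) = w"
      by (rule copair_eqI[symmetric]) auto
    then show "copair C (w \<cdot> ?i) (w \<cdot> ?j) \<cdot> z = Id C Z"
      by (simp add: wz)
  qed (auto simp: hom_def)
qed

text \<open>Solutions of \<open>e : X \<rightarrow> H X + Z\<close> correspond to coalgebra morphisms from \<open>X + Z\<close> to the final
  coalgebra \<open>Z\<close>, by extending with the identity of \<open>Z\<close>.\<close>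

lemma final_coalgebra_is_free_cia:
  assumes z: "final_coalgebra C (plus_functor C H Y) Z z" and Y: "Y \<in> Obj C"
    and \<tau>: "\<tau> \<in> hom C (OMap H Z) Z" and \<eta>: "\<eta> \<in> hom C Y Z"
    and z\<tau>: "z \<cdot> \<tau> = Inl C (OMap H Z) Y" and z\<eta>: "z \<cdot> \<eta> = Inr C (OMap H Z) Y"
    and \<tau>\<eta>z: "copair C \<tau> \<eta> \<cdot> z = Id C Z"
  shows "is_free_cia C H Y (Z, \<tau>, \<eta>)"
proof -
  note fin = final_coalgebra_plus[OF z Y]
  note [simp] = fin(1) homE[OF fin(2)] homE[OF \<tau>] homE[OF \<eta>] Y z\<tau> z\<eta>
  let ?i = "Inl C (OMap H Z) Y" and ?j = "Inr C (OMap H Z) Y"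
  have alg: "is_algebra C H Z \<tau>"
    using \<tau> by (simp add: is_algebra_def)
  have z\<tau>k [simp]: "z \<cdot> \<tau> \<cdot> k = ?i \<cdot> k" if "k \<in> Arr C" "Cod C k = OMap H Z" for k
    using Comp_assoc_simp[of k \<tau> z] that by auto
  have z_inj: "h = k" if "h \<in> hom C X Z" "k \<in> hom C X Z" "z \<cdot> h = z \<cdot> k" for h k X
  proof -
    have "copair C \<tau> \<eta> \<cdot> z \<cdot> h = copair C \<tau> \<eta> \<cdot> z \<cdot> k"
      using that by simp
    then have "(copair C \<tau> \<eta> \<cdot> z) \<cdot> h = (copair C \<tau> \<eta> \<cdot> z) \<cdot> k"
      using that by (simp add: hom_def)
    then show ?thesis
      using that by (simp add: \<tau>\<eta>z hom_def)
  qed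
  have "\<exists>!s. is_solution C H Z \<tau> e s" if e: "e \<in> hom C X (OMap H X \<amalg> Z)" for e X
  proof -
    note [simp] = homE[OF e] hom_Obj[OF e]
    let ?W = "X \<amalg> Z"
    \<comment> \<open>\<open>c\<close> is \<open>z \<oplus> e\<close> in copair form: the coalgebra
      on \<open>X + Z\<close> that runs \<open>e\<close> on \<open>X\<close> and \<open>z\<close> on
      \<open>Z\<close>.\<close>
    define r where "r = copair C (Inl C (OMap H ?W) Y \<cdot> AMap H (Inr C X Z)) (Inr C (OMap H ?W) Y) \<cdot> z"
    define c where "c = copair C (copair C (Inl C (OMap H ?W) Y \<cdot> AMap H (Inl C X Z)) r \<cdot> e) r"
    have c: "c \<in> hom C ?W (OMap H ?W \<amalg> Y)"
      by (simp add: c_def r_def hom_def)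
    let ?hom = "\<lambda>h. z \<cdot> h = copair C (?i \<cdot> AMap H h) ?j \<cdot> c"
    \<comment> \<open>As \<open>z\<close> is monic, both sides of the solution equation may be
      compared after composing with \<open>z\<close>; the \<open>Z\<close> component of the
      coalgebra square for \<open>[s, id]\<close> reads \<open>z = z\<close>.\<close>
    have copair_hom: "is_solution C H Z \<tau> e s \<longleftrightarrow> s \<in> hom C X Z \<and> ?hom (copair C s (Id C Z))" for s
    proof (cases "s \<in> hom C X Z")
      case True
      note [simp] = homE[OF True]
      have "copair C (\<tau> \<cdot> AMap H s) (Id C Z) \<cdot> e = s \<longleftrightarrow>
          z \<cdot> s = z \<cdot> copair C (\<tau> \<cdot> AMap H s) (Id C Z) \<cdot> e"
      proof
        assume "z \<cdot> s = z \<cdot> copair C (\<tau> \<cdot> AMap H s) (Id C Z) \<cdot> e"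
        from z_inj[OF True _ this] show "copair C (\<tau> \<cdot> AMap H s) (Id C Z) \<cdot> e = s"
          by (simp add: hom_iff)
      qed (simp only:)
      also have "z \<cdot> copair C (\<tau> \<cdot> AMap H s) (Id C Z) \<cdot> e = copair C (?i \<cdot> AMap H s) z \<cdot> e"
        by simp
      also have "z \<cdot> s = copair C (?i \<cdot> AMap H s) z \<cdot> e \<longleftrightarrow>
          copair C (z \<cdot> s) z = copair C (copair C (?i \<cdot> AMap H s) z \<cdot> e) z"
      proof
        assume "copair C (z \<cdot> s) z = copair C (copair C (?i \<cdot> AMap H s) z \<cdot> e) z"
        from arg_cong[OF this, of "\<lambda>u. u \<cdot> Inl C X Z"] show "z \<cdot> s = copair C (?i \<cdot> AMap H s) z \<cdot> e"
          by simp
      qed simp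
      also have "\<dots> \<longleftrightarrow> ?hom (copair C s (Id C Z))"
        by (simp add: c_def r_def)
      finally show ?thesis
        using is_solution_iff[OF alg e] True by simp
    qed (simp add: is_solution_def)
    \<comment> \<open>\<open>inr\<close> is a coalgebra morphism from \<open>z\<close> to
      \<open>c\<close>, so \<open>h \<cdot> inr\<close> is an endomorphism of the final
      coalgebra.\<close>
    have hom_copair: "h = copair C (h \<cdot> Inl C X Z) (Id C Z)" if h: "h \<in> hom C ?W Z" "?hom h" for h
    proof -
      note [simp] = homE[OF h(1)]
      have "z \<cdot> h \<cdot> Inr C X Z = (copair C (?i \<cdot> AMap H h) ?j \<cdot> c) \<cdot> Inr C X Z"
        unfolding h(2)[symmetric] by simp
      also have "\<dots> = copair C (?i \<cdot> AMap H (h \<cdot> Inr C X Z)) ?j \<cdot> z"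
        by (simp add: c_def r_def)
      finally have "h \<cdot> Inr C X Z = Id C Z"
        by (intro final_coalgebra_endo[OF z Y]) (auto simp: hom_def)
      then show ?thesis
        by (intro copair_eqI) auto
    qed
    obtain h where h: "h \<in> hom C ?W Z" "?hom h" and uniq: "\<And>k. k \<in> hom C ?W Z \<Longrightarrow> ?hom k \<Longrightarrow> k = h"
      using fin(3)[OF c] by blast
    show ?thesis
    proof (rule ex1I[of _ "h \<cdot> Inl C X Z"])
      show "is_solution C H Z \<tau> e (h \<cdot> Inl C X Z)"
        unfolding copair_hom using h hom_copair[OF h] by (simp add: hom_def)
      show "s = h \<cdot> Inl C X Z" if "is_solution C H Z \<tau> e s" for s
        using that uniq[of "copair C s (Id C Z)"] unfolding copair_hom by (auto simp: hom_def)
    qed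
  qed
  then have cia: "is_cia C H Z \<tau>"
    using alg unfolding is_cia_def by (meson flat_eqsE)
  have "\<exists>!h. h \<in> algebra_hom C H Z \<tau> A \<alpha> \<and> h \<cdot> \<eta> = f"
    if A: "is_cia C H A \<alpha>" and f: "f \<in> hom C Y A" for A \<alpha> f
  proof -
    have alg: "is_algebra C H A \<alpha>"
      using A by (simp add: is_cia_def)
    then have \<alpha>: "\<alpha> \<in> hom C (OMap H A) A"
      by (simp add: is_algebra_def)
    note [simp] = homE[OF \<alpha>] homE[OF f] hom_Obj[OF f]
    \<comment> \<open>\<open>?e\<close> is \<open>f \<bullet> z\<close>. Since
      \<open>[\<tau>, \<eta>]\<close> inverts \<open>z\<close>, its solutions are exactly the
      homomorphisms extending \<open>f\<close>, and \<open>A\<close> being completely iterative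
      gives exactly one.\<close>
    let ?e = "copair C (Inl C (OMap H Z) A) (Inr C (OMap H Z) A \<cdot> f) \<cdot> z"
    have e: "?e \<in> hom C Z (OMap H Z \<amalg> A)"
      by (simp add: hom_def)
    have "h \<in> algebra_hom C H Z \<tau> A \<alpha> \<and> h \<cdot> \<eta> = f \<longleftrightarrow> is_solution C H A \<alpha> ?e h" for h
    proof (cases "h \<in> hom C Z A")
      case True
      note [simp] = homE[OF True]
      have "is_solution C H A \<alpha> ?e h \<longleftrightarrow> copair C (\<alpha> \<cdot> AMap H h) f \<cdot> z = h"
        using is_solution_iff[OF alg e] True by simp
      also have "\<dots> \<longleftrightarrow> h \<cdot> \<tau> = \<alpha> \<cdot> AMap H h \<and> h \<cdot> \<eta> = f"
      proof
        assume h: "copair C (\<alpha> \<cdot> AMap H h) f \<cdot> z = h"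
        have "h \<cdot> \<tau> = (copair C (\<alpha> \<cdot> AMap H h) f \<cdot> z) \<cdot> \<tau>" "h \<cdot> \<eta> = (copair C (\<alpha> \<cdot> AMap H h) f \<cdot> z) \<cdot> \<eta>"
          unfolding h by simp_all
        then show "h \<cdot> \<tau> = \<alpha> \<cdot> AMap H h \<and> h \<cdot> \<eta> = f"
          by simp
      next
        assume h: "h \<cdot> \<tau> = \<alpha> \<cdot> AMap H h \<and> h \<cdot> \<eta> = f"
        have "copair C (\<alpha> \<cdot> AMap H h) f \<cdot> z = h \<cdot> copair C \<tau> \<eta> \<cdot> z"
          by (simp add: h)
        also have "\<dots> = h"
          unfolding \<tau>\<eta>z by simp
        finally show "copair C (\<alpha> \<cdot> AMap H h) f \<cdot> z = h" .
      qed
      finally show ?thesis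
        using True by (simp add: algebra_hom_def)
    qed (auto simp: algebra_hom_def is_solution_def)
    then show ?thesis
      using A flat_eqsI[OF e] by (simp add: is_cia_def)
  qed
  then show ?thesis
    using cia \<eta> by (auto simp: is_free_cia_def)
qed

end

section \<open>The free completely iterative monad\<close>

locale iteratable_endofunctor = coprod_endofunctor C H
  for C :: "('o, 'm, 'z) coprod_category_scheme" (structure) and H :: "('o, 'm, 'o, 'm) func" +
  assumes iteratable: "iteratable C H"
begin

abbreviation "T \<equiv> cia_carrier C H"
abbreviation "\<tau> \<equiv> cia_struct C H"
abbreviation "\<eta> \<equiv> cia_unit C H"
abbreviation "Tm \<equiv> AMap (Fun (free_ci_monad C H))"
abbreviation "\<mu> \<equiv> Mult (free_ci_monad C H)"

text \<open>The inverse \<open>z\<close> is recorded along with the free algebra because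
  \<open>free_cia\<close> may pick a different free algebra, to which \<open>z\<close> has to be
  transported.\<close>

lemma free_cia_inverse:
  assumes "Y \<in> Obj C"
  obtains Z \<tau>' \<eta>' z where "is_free_cia C H Y (Z, \<tau>', \<eta>')" "z \<in> hom C Z (OMap H Z \<amalg> Y)"
    "z \<cdot> \<tau>' = Inl C (OMap H Z) Y" "z \<cdot> \<eta>' = Inr C (OMap H Z) Y" "copair C \<tau>' \<eta>' \<cdot> z = Id C Z"
proof -
  obtain Z z where z: "final_coalgebra C (plus_functor C H Y) Z z"
    using iteratable assms unfolding iteratable_def by blast
  then show ?thesis
    using final_coalgebra_inverse[OF z assms] final_coalgebra_is_free_cia[OF z assms]
      final_coalgebra_plus(2)[OF z assms] that by metis
qed

lemma is_free_cia_T: "Y \<in> Obj C \<Longrightarrow> is_free_cia C H Y (T Y, \<tau> Y, \<eta> Y)"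
  using free_cia_inverse[of Y] someI_ex[of "is_free_cia C H Y"]
  unfolding cia_carrier_def cia_struct_def cia_unit_def free_cia_def
  by (metis prod.collapse)

lemma is_cia_T: "Y \<in> Obj C \<Longrightarrow> is_cia C H (T Y) (\<tau> Y)"
  using is_free_cia_T by (simp add: is_free_cia_def)

lemma is_algebra_T: "Y \<in> Obj C \<Longrightarrow> is_algebra C H (T Y) (\<tau> Y)"
  using is_cia_T by (simp add: is_cia_def)

lemma T_simps [simp]:
  assumes "Y \<in> Obj C"
  shows "T Y \<in> Obj C"
    "\<tau> Y \<in> Arr C" "Dom C (\<tau> Y) = OMap H (T Y)" "Cod C (\<tau> Y) = T Y"
    "\<eta> Y \<in> Arr C" "Dom C (\<eta> Y) = Y" "Cod C (\<eta> Y) = T Y"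
  using is_free_cia_T[OF assms] is_algebra_T[OF assms]
  by (auto simp: is_free_cia_def is_algebra_def hom_def)

lemma cia_ext_unique:
  assumes "is_cia C H A \<alpha>" "f \<in> hom C Y A"
  shows "\<exists>!h. h \<in> algebra_hom C H (T Y) (\<tau> Y) A \<alpha> \<and> h \<cdot> \<eta> Y = f"
  using is_free_cia_T[of Y] hom_Obj[OF assms(2)] assms by (auto simp: is_free_cia_def)

lemma cia_ext:
  assumes "is_cia C H A \<alpha>" "f \<in> hom C Y A"
  shows "cia_ext C H Y A \<alpha> f \<in> hom C (T Y) A"
    "cia_ext C H Y A \<alpha> f \<cdot> \<tau> Y = \<alpha> \<cdot> AMap H (cia_ext C H Y A \<alpha> f)"
    "cia_ext C H Y A \<alpha> f \<cdot> \<eta> Y = f"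
  using theI'[OF cia_ext_unique[OF assms]] by (auto simp: cia_ext_def algebra_hom_def)

lemma algebra_hom_T_eqI:
  assumes "is_cia C H A \<alpha>" "h \<in> hom C (T Y) A" "k \<in> hom C (T Y) A" "Y \<in> Obj C"
    and "h \<cdot> \<tau> Y = \<alpha> \<cdot> AMap H h" "k \<cdot> \<tau> Y = \<alpha> \<cdot> AMap H k" "h \<cdot> \<eta> Y = k \<cdot> \<eta> Y"
  shows "h = k"
proof -
  have "k \<cdot> \<eta> Y \<in> hom C Y A"
    using homE[OF assms(3)] assms(4) by (simp add: hom_iff)
  from cia_ext_unique[OF assms(1) this] show ?thesis
    using assms by (auto simp: algebra_hom_def)
qed

section \<open>Functor action and multiplication of the monad\<close>

lemma Tm_simps [simp]:
  assumes "f \<in> Arr C"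
  shows "Tm f \<in> Arr C" "Dom C (Tm f) = T (Dom C f)" "Cod C (Tm f) = T (Cod C f)"
    and "Dom C f = X \<Longrightarrow> Tm f \<cdot> \<tau> X = \<tau> (Cod C f) \<cdot> AMap H (Tm f)"
    and "Dom C f = X \<Longrightarrow> Tm f \<cdot> \<eta> X = \<eta> (Cod C f) \<cdot> f"
proof -
  have "\<eta> (Cod C f) \<cdot> f \<in> hom C (Dom C f) (T (Cod C f))"
    using assms by (simp add: hom_iff)
  from cia_ext[OF is_cia_T this] show "Tm f \<in> Arr C" "Dom C (Tm f) = T (Dom C f)"
    "Cod C (Tm f) = T (Cod C f)"
    "Dom C f = X \<Longrightarrow> Tm f \<cdot> \<tau> X = \<tau> (Cod C f) \<cdot> AMap H (Tm f)"
    "Dom C f = X \<Longrightarrow> Tm f \<cdot> \<eta> X = \<eta> (Cod C f) \<cdot> f"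
    using assms by (auto simp: free_ci_monad_def hom_iff)
qed

lemma \<mu>_simps [simp]:
  assumes "Y \<in> Obj C"
  shows "\<mu> Y \<in> Arr C" "Dom C (\<mu> Y) = T (T Y)" "Cod C (\<mu> Y) = T Y"
    "\<mu> Y \<cdot> \<tau> (T Y) = \<tau> Y \<cdot> AMap H (\<mu> Y)" "\<mu> Y \<cdot> \<eta> (T Y) = Id C (T Y)"
  using cia_ext[OF is_cia_T[OF assms] Id_in_hom] assms
  by (auto simp: free_ci_monad_def hom_iff)

lemma T_Comp_simps [simp]:
  assumes "k \<in> Arr C"
  shows "f \<in> Arr C \<Longrightarrow> Dom C f = X \<Longrightarrow> Cod C k = OMap H (T X) \<Longrightarrow>
      Tm f \<cdot> \<tau> X \<cdot> k = \<tau> (Cod C f) \<cdot> AMap H (Tm f) \<cdot> k"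
    and "f \<in> Arr C \<Longrightarrow> Dom C f = X \<Longrightarrow> Cod C k = X \<Longrightarrow> Tm f \<cdot> \<eta> X \<cdot> k = \<eta> (Cod C f) \<cdot> f \<cdot> k"
    and "Y \<in> Obj C \<Longrightarrow> Cod C k = OMap H (T (T Y)) \<Longrightarrow> \<mu> Y \<cdot> \<tau> (T Y) \<cdot> k = \<tau> Y \<cdot> AMap H (\<mu> Y) \<cdot> k"
    and "Y \<in> Obj C \<Longrightarrow> Cod C k = T Y \<Longrightarrow> \<mu> Y \<cdot> \<eta> (T Y) \<cdot> k = k"
proof -
  show "Tm f \<cdot> \<tau> X \<cdot> k = \<tau> (Cod C f) \<cdot> AMap H (Tm f) \<cdot> k"
    if "f \<in> Arr C" "Dom C f = X" "Cod C k = OMap H (T X)"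
    using Comp_reassoc[OF Tm_simps(4)[OF that(1,2)] assms] that assms by force
  show "Tm f \<cdot> \<eta> X \<cdot> k = \<eta> (Cod C f) \<cdot> f \<cdot> k" if "f \<in> Arr C" "Dom C f = X" "Cod C k = X"
    using Comp_reassoc[OF Tm_simps(5)[OF that(1,2)] assms] that assms by force
  show "\<mu> Y \<cdot> \<tau> (T Y) \<cdot> k = \<tau> Y \<cdot> AMap H (\<mu> Y) \<cdot> k"
    if "Y \<in> Obj C" "Cod C k = OMap H (T (T Y))"
    using Comp_reassoc[OF \<mu>_simps(4)[OF that(1)] assms] that assms by simp
  show "\<mu> Y \<cdot> \<eta> (T Y) \<cdot> k = k" if "Y \<in> Obj C" "Cod C k = T Y"
    using Comp_reassoc[OF \<mu>_simps(5)[OF that(1)] assms] that assms by simp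
qed

lemma Tm_Id: "X \<in> Obj C \<Longrightarrow> Tm (Id C X) = Id C (T X)"
  by (rule algebra_hom_T_eqI[where Y = X, OF is_cia_T[of X]]) (simp_all add: hom_iff)

lemma Tm_Comp:
  assumes "f \<in> Arr C" "g \<in> Arr C" "Dom C g = Cod C f"
  shows "Tm (g \<cdot> f) = Tm g \<cdot> Tm f"
  by (rule algebra_hom_T_eqI[where Y = "Dom C f", OF is_cia_T[of "Cod C g"]]) (simp_all add: hom_iff assms)

section \<open>The inverse of \<open>[\<tau>, \<eta>]\<close>\<close>

definition out :: "'o \<Rightarrow> 'm" where
  "out Y = (SOME t. t \<in> hom C (T Y) (OMap H (T Y) \<amalg> Y) \<and> t \<cdot> \<tau> Y = Inl C (OMap H (T Y)) Y \<and>
    t \<cdot> \<eta> Y = Inr C (OMap H (T Y)) Y \<and> copair C (\<tau> Y) (\<eta> Y) \<cdot> t = Id C (T Y))"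

text \<open>Freeness of both algebras gives homomorphisms \<open>h : Z \<rightarrow> T Y\<close> and
  \<open>k : T Y \<rightarrow> Z\<close> preserving units, and \<open>h \<cdot> k = id\<close> by
  uniqueness. The witness \<open>t\<close> is \<open>z\<close> transported along them,
  \<open>(H h + id) \<cdot> z \<cdot> k\<close>.\<close>

lemma out:
  assumes Y [simp]: "Y \<in> Obj C"
  shows "out Y \<in> hom C (T Y) (OMap H (T Y) \<amalg> Y) \<and> out Y \<cdot> \<tau> Y = Inl C (OMap H (T Y)) Y \<and>
    out Y \<cdot> \<eta> Y = Inr C (OMap H (T Y)) Y \<and> copair C (\<tau> Y) (\<eta> Y) \<cdot> out Y = Id C (T Y)"
proof -
  obtain Z \<tau>' \<eta>' z where free: "is_free_cia C H Y (Z, \<tau>', \<eta>')" and z: "z \<in> hom C Z (OMap H Z \<amalg> Y)"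
    and z\<tau> [simp]: "z \<cdot> \<tau>' = Inl C (OMap H Z) Y" and z\<eta> [simp]: "z \<cdot> \<eta>' = Inr C (OMap H Z) Y"
    and \<tau>\<eta>z: "copair C \<tau>' \<eta>' \<cdot> z = Id C Z"
    using free_cia_inverse[OF Y] by blast
  have cia: "is_cia C H Z \<tau>'" and \<eta>': "\<eta>' \<in> hom C Y Z" and \<tau>': "\<tau>' \<in> hom C (OMap H Z) Z"
    using free by (auto simp: is_free_cia_def is_cia_def is_algebra_def)
  note [simp] = homE[OF z] hom_Obj[OF z] homE[OF \<eta>'] homE[OF \<tau>']
  have "\<eta> Y \<in> hom C Y (T Y)"
    by (simp add: hom_iff)
  then obtain h where "h \<in> algebra_hom C H Z \<tau>' (T Y) (\<tau> Y)" and h\<eta> [simp]: "h \<cdot> \<eta>' = \<eta> Y"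
    using free is_cia_T[OF Y] unfolding is_free_cia_def by blast
  then have h: "h \<in> hom C Z (T Y)" and h\<tau> [simp]: "h \<cdot> \<tau>' = \<tau> Y \<cdot> AMap H h"
    by (auto simp: algebra_hom_def)
  obtain k where k: "k \<in> hom C (T Y) Z" and k\<tau> [simp]: "k \<cdot> \<tau> Y = \<tau>' \<cdot> AMap H k"
    and k\<eta> [simp]: "k \<cdot> \<eta> Y = \<eta>'"
    using cia_ext[OF cia \<eta>'] by blast
  note [simp] = homE[OF h] homE[OF k]
  have h\<tau>' [simp]: "h \<cdot> \<tau>' \<cdot> u = \<tau> Y \<cdot> AMap H h \<cdot> u" if "u \<in> Arr C" "Cod C u = OMap H Z" for u
    using Comp_reassoc[OF h\<tau> that(1)] that by simp
  have z\<tau>' [simp]: "z \<cdot> \<tau>' \<cdot> u = Inl C (OMap H Z) Y \<cdot> u" if "u \<in> Arr C" "Cod C u = OMap H Z" for u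
    using Comp_reassoc[OF z\<tau> that(1)] that by simp
  have hk: "h \<cdot> k = Id C (T Y)"
    by (rule algebra_hom_T_eqI[where Y = Y, OF is_cia_T[OF Y]]) (simp_all add: hom_iff)
  then have Hhk: "AMap H h \<cdot> AMap H k = Id C (OMap H (T Y))"
    by (metis H.AMap_Comp H.AMap_Id T_simps(1) Y h k)
  define t where "t = copair C (Inl C (OMap H (T Y)) Y \<cdot> AMap H h) (Inr C (OMap H (T Y)) Y) \<cdot> z \<cdot> k"
  have "copair C (\<tau> Y) (\<eta> Y) \<cdot> t = h \<cdot> (copair C \<tau>' \<eta>' \<cdot> z) \<cdot> k"
    by (simp add: t_def)
  also have "\<dots> = Id C (T Y)"
    unfolding \<tau>\<eta>z by (simp add: hk)
  finally have "t \<in> hom C (T Y) (OMap H (T Y) \<amalg> Y) \<and> t \<cdot> \<tau> Y = Inl C (OMap H (T Y)) Y \<and>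
    t \<cdot> \<eta> Y = Inr C (OMap H (T Y)) Y \<and> copair C (\<tau> Y) (\<eta> Y) \<cdot> t = Id C (T Y)"
    by (simp add: t_def hom_iff Hhk)
  then show ?thesis
    unfolding out_def by (rule someI)
qed

lemma out_simps [simp]:
  assumes "Y \<in> Obj C"
  shows "out Y \<in> Arr C" "Dom C (out Y) = T Y" "Cod C (out Y) = OMap H (T Y) \<amalg> Y"
    "out Y \<cdot> \<tau> Y = Inl C (OMap H (T Y)) Y" "out Y \<cdot> \<eta> Y = Inr C (OMap H (T Y)) Y"
    "copair C (\<tau> Y) (\<eta> Y) \<cdot> out Y = Id C (T Y)"
  using out[OF assms] by (auto simp: hom_iff)

lemma out_in_hom: "Y \<in> Obj C \<Longrightarrow> out Y \<in> hom C (T Y) (OMap H (T Y) \<amalg> Y)"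
  by (simp add: hom_iff)

lemma out_Comp_simps [simp]:
  assumes "k \<in> Arr C" "Y \<in> Obj C"
  shows "Cod C k = OMap H (T Y) \<Longrightarrow> out Y \<cdot> \<tau> Y \<cdot> k = Inl C (OMap H (T Y)) Y \<cdot> k"
    and "Cod C k = Y \<Longrightarrow> out Y \<cdot> \<eta> Y \<cdot> k = Inr C (OMap H (T Y)) Y \<cdot> k"
  using Comp_reassoc[OF out_simps(4)[OF assms(2)] assms(1)]
    Comp_reassoc[OF out_simps(5)[OF assms(2)] assms(1)] assms by simp_all

text \<open>\<open>[\<tau>, \<eta>]\<close> has the section \<open>out\<close>, so
  \<open>\<tau>\<close> and \<open>\<eta>\<close> are jointly epic. Unlike
  \<open>algebra_hom_T_eqI\<close>, this compares arbitrary morphisms into any object.\<close>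

lemma T_eqI:
  assumes h: "h \<in> hom C (T Y) Z" and k: "k \<in> hom C (T Y) Z" and Y: "Y \<in> Obj C"
    and eq: "h \<cdot> \<tau> Y = k \<cdot> \<tau> Y" "h \<cdot> \<eta> Y = k \<cdot> \<eta> Y"
  shows "h = k"
proof -
  have *: "copair C (u \<cdot> \<tau> Y) (u \<cdot> \<eta> Y) \<cdot> out Y = u" if "u \<in> hom C (T Y) Z" for u
  proof -
    have "copair C (u \<cdot> \<tau> Y) (u \<cdot> \<eta> Y) \<cdot> out Y = u \<cdot> copair C (\<tau> Y) (\<eta> Y) \<cdot> out Y"
      using homE[OF that] Y by (simp del: out_simps(6))
    then show ?thesis
      using homE[OF that] Y by simp
  qed
  show ?thesis
    using *[OF h] *[OF k] unfolding eq by (rule trans[OF sym])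
qed

section \<open>Canonical solutions in the free algebra\<close>

definition cia_sol :: "'o \<Rightarrow> 'm \<Rightarrow> 'm" where
  "cia_sol Y e = (THE s. s \<in> hom C (Dom C e) (T Y) \<and> copair C (\<tau> Y \<cdot> AMap H s) (\<eta> Y) \<cdot> e = s)"

text \<open>The equation says that \<open>s\<close> solves \<open>\<eta> \<bullet> e\<close> in the
  completely iterative algebra \<open>T Y\<close>, because \<open>[\<tau> \<cdot> H s, id] \<cdot>
  (\<eta> \<bullet> e) = [\<tau> \<cdot> H s, \<eta>] \<cdot> e\<close>.\<close>

lemma ex1_cia_sol:
  assumes e: "e \<in> hom C X (OMap H X \<amalg> Y)" and Y: "Y \<in> Obj C"
  shows "\<exists>!s. s \<in> hom C X (T Y) \<and> copair C (\<tau> Y \<cdot> AMap H s) (\<eta> Y) \<cdot> e = s"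
proof -
  have \<eta>: "\<eta> Y \<in> hom C Y (T Y)"
    using Y by (simp add: hom_iff)
  note [simp] = homE[OF e] hom_Obj[OF e] Y
  note ren = rename_params_in_hom[OF e \<eta> Y]
  have "is_solution C H (T Y) (\<tau> Y) (rename_params C H (\<eta> Y) e) s \<longleftrightarrow>
      s \<in> hom C X (T Y) \<and> copair C (\<tau> Y \<cdot> AMap H s) (\<eta> Y) \<cdot> e = s" for s
    unfolding is_solution_iff[OF is_algebra_T[OF Y] ren]
    unfolding rename_params_eq[OF e \<eta> Y]
    by (auto simp: hom_iff)
  then show ?thesis
    using is_cia_T[OF Y] flat_eqsI[OF ren] unfolding is_cia_def by metis
qed

lemma cia_sol:
  assumes e: "e \<in> hom C X (OMap H X \<amalg> Y)" and Y: "Y \<in> Obj C"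
  shows "cia_sol Y e \<in> hom C X (T Y)"
    and "copair C (\<tau> Y \<cdot> AMap H (cia_sol Y e)) (\<eta> Y) \<cdot> e = cia_sol Y e"
  using theI'[OF ex1_cia_sol[OF assms]] homE[OF e] by (auto simp: cia_sol_def)

lemma cia_sol_eqI:
  assumes "e \<in> hom C X (OMap H X \<amalg> Y)" "Y \<in> Obj C"
    and "s \<in> hom C X (T Y)" "copair C (\<tau> Y \<cdot> AMap H s) (\<eta> Y) \<cdot> e = s"
  shows "cia_sol Y e = s"
  using ex1_cia_sol[OF assms(1,2)] cia_sol[OF assms(1,2)] assms(3,4) by blast

text \<open>Composing the fixed-point equation with \<open>out\<close> shows that
  \<open>cia_sol Y e\<close> is a morphism of equations from \<open>e\<close> to
  \<open>out Y\<close>, which is the square that functoriality asks for.\<close>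

lemma out_cia_sol:
  assumes e: "e \<in> hom C X (OMap H X \<amalg> Y)" and Y: "Y \<in> Obj C"
  shows "out Y \<cdot> cia_sol Y e =
    copair C (Inl C (OMap H (T Y)) Y \<cdot> AMap H (cia_sol Y e)) (Inr C (OMap H (T Y)) Y) \<cdot> e"
proof -
  note [simp] = homE[OF e] hom_Obj[OF e] Y homE[OF cia_sol(1)[OF assms]]
  have "out Y \<cdot> cia_sol Y e = out Y \<cdot> copair C (\<tau> Y \<cdot> AMap H (cia_sol Y e)) (\<eta> Y) \<cdot> e"
    by (simp only: cia_sol(2)[OF assms])
  then show ?thesis
    by simp
qed

lemma cia_sol_out: "Y \<in> Obj C \<Longrightarrow> cia_sol Y (out Y) = Id C (T Y)"
  by (rule cia_sol_eqI) (auto simp: hom_iff)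

text \<open>\<open>Tm h\<close> is a homomorphism taking \<open>\<eta> Y\<close> to
  \<open>\<eta> Z \<cdot> h\<close>, so it carries the fixed-point equation of \<open>e\<close> to
  that of \<open>h \<bullet> e\<close>; uniqueness does the rest.\<close>

lemma cia_sol_rename:
  assumes e: "e \<in> hom C X (OMap H X \<amalg> Y)" and h: "h \<in> hom C Y Z"
  shows "cia_sol Z (rename_params C H h e) = Tm h \<cdot> cia_sol Y e"
proof -
  have Y: "Y \<in> Obj C" and Z: "Z \<in> Obj C"
    using hom_Obj[OF h] by auto
  note [simp] = homE[OF e] hom_Obj[OF e] homE[OF h] Y Z homE[OF cia_sol(1)[OF e Y]]
  show ?thesis
  proof (rule cia_sol_eqI[OF rename_params_in_hom[OF e h Y] Z])
    have "copair C (\<tau> Z \<cdot> AMap H (Tm h \<cdot> cia_sol Y e)) (\<eta> Z) \<cdot> rename_params C H h e =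
        Tm h \<cdot> copair C (\<tau> Y \<cdot> AMap H (cia_sol Y e)) (\<eta> Y) \<cdot> e"
      unfolding rename_params_eq[OF e h Y] by simp
    then show "copair C (\<tau> Z \<cdot> AMap H (Tm h \<cdot> cia_sol Y e)) (\<eta> Z) \<cdot> rename_params C H h e =
        Tm h \<cdot> cia_sol Y e"
      by (simp only: cia_sol(2)[OF e Y])
  qed (simp add: hom_iff)
qed

lemma cia_sol_functorial:
  assumes e: "e \<in> hom C X (OMap H X \<amalg> A)" and f: "f \<in> hom C Y (OMap H Y \<amalg> A)"
    and h: "h \<in> hom C X Y" and A: "A \<in> Obj C"
    and eq: "coprod_map C (AMap H h) (Id C A) \<cdot> e = f \<cdot> h"
  shows "cia_sol A e = cia_sol A f \<cdot> h"
proof (rule cia_sol_eqI[OF e A])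
  note [simp] = homE[OF e] hom_Obj[OF e] homE[OF f] hom_Obj[OF f] homE[OF h] A homE[OF cia_sol(1)[OF f A]]
  have "copair C (\<tau> A \<cdot> AMap H (cia_sol A f \<cdot> h)) (\<eta> A) \<cdot> e =
      copair C (\<tau> A \<cdot> AMap H (cia_sol A f)) (\<eta> A) \<cdot> coprod_map C (AMap H h) (Id C A) \<cdot> e"
    by (simp add: coprod_map_def)
  also have "\<dots> = (copair C (\<tau> A \<cdot> AMap H (cia_sol A f)) (\<eta> A) \<cdot> f) \<cdot> h"
    unfolding eq by simp
  also have "\<dots> = cia_sol A f \<cdot> h"
    by (simp only: cia_sol(2)[OF f A])
  finally show "copair C (\<tau> A \<cdot> AMap H (cia_sol A f \<cdot> h)) (\<eta> A) \<cdot> e = cia_sol A f \<cdot> h" .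
  show "cia_sol A f \<cdot> h \<in> hom C X (T A)"
    by (simp add: hom_iff)
qed

text \<open>The solution of \<open>f \<oplus> e\<close> is found explicitly as
  \<open>[?u, ?t]\<close>, and uniqueness confirms it.\<close>

lemma cia_sol_compositional:
  assumes e: "e \<in> hom C X (OMap H X \<amalg> Y)" and f: "f \<in> hom C Y (OMap H Y \<amalg> A)" and A: "A \<in> Obj C"
  shows "cia_sol A (plus_eq C H A f e) \<cdot> Inl C X Y = \<mu> A \<cdot> Tm (cia_sol A f) \<cdot> cia_sol Y e"
proof -
  have Y: "Y \<in> Obj C"
    using hom_Obj[OF f] by simp
  let ?s = "cia_sol Y e" and ?t = "cia_sol A f"
  note [simp] = homE[OF e] hom_Obj[OF e] homE[OF f] Y A homE[OF cia_sol(1)[OF e Y]]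
    homE[OF cia_sol(1)[OF f A]]
  let ?u = "\<mu> A \<cdot> Tm ?t \<cdot> ?s"
  have "copair C (\<tau> A \<cdot> AMap H (copair C ?u ?t)) (\<eta> A) \<cdot> plus_eq C H A f e =
    copair C (copair C (\<tau> A \<cdot> AMap H ?u) (copair C (\<tau> A \<cdot> AMap H ?t) (\<eta> A) \<cdot> f) \<cdot> e)
      (copair C (\<tau> A \<cdot> AMap H ?t) (\<eta> A) \<cdot> f)"
    unfolding plus_eq_eq[OF e f A] by (simp del: H.AMap_Comp_simp)
  also have "\<dots> = copair C (copair C (\<tau> A \<cdot> AMap H ?u) ?t \<cdot> e) ?t"
    by (simp only: cia_sol(2)[OF f A])
  \<comment> \<open>\<open>\<mu> A \<cdot> Tm ?t\<close> is the homomorphism extending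
    \<open>?t\<close>, so it takes the fixed-point equation of \<open>?s\<close> to the
    \<open>X\<close> component wanted here.\<close>
  also have "copair C (\<tau> A \<cdot> AMap H ?u) ?t \<cdot> e =
      \<mu> A \<cdot> Tm ?t \<cdot> copair C (\<tau> Y \<cdot> AMap H ?s) (\<eta> Y) \<cdot> e"
    by simp
  also have "\<dots> = ?u"
    by (simp only: cia_sol(2)[OF e Y])
  finally have "cia_sol A (plus_eq C H A f e) = copair C ?u ?t"
    by (intro cia_sol_eqI[OF plus_eq_in_hom[OF e f A] A]) (simp_all add: hom_iff)
  then show ?thesis
    by simp
qed


section \<open>From complete Elgot algebras to Eilenberg--Moore algebras\<close>

lemma elgotD:
  assumes "complete_elgot_algebra C H A \<alpha> sol"
  shows "is_algebra C H A \<alpha>" "A \<in> Obj C" "\<alpha> \<in> hom C (OMap H A) A" "sol \<in> extensional (flat_eqs C H A)"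
    and "e \<in> hom C X (OMap H X \<amalg> A) \<Longrightarrow> sol e \<in> hom C X A"
    and "e \<in> hom C X (OMap H X \<amalg> A) \<Longrightarrow> copair C (\<alpha> \<cdot> AMap H (sol e)) (Id C A) \<cdot> e = sol e"
proof -
  show alg: "is_algebra C H A \<alpha>" and "A \<in> Obj C" "\<alpha> \<in> hom C (OMap H A) A"
    "sol \<in> extensional (flat_eqs C H A)"
    using assms by (auto simp: complete_elgot_algebra_def is_algebra_def)
  assume e: "e \<in> hom C X (OMap H X \<amalg> A)"
  then have "is_solution C H A \<alpha> e (sol e)"
    using assms flat_eqsI by (simp add: complete_elgot_algebra_def)
  then show "sol e \<in> hom C X A" "copair C (\<alpha> \<cdot> AMap H (sol e)) (Id C A) \<cdot> e = sol e"
    unfolding is_solution_iff[OF alg e] by auto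
qed

lemma elgot_functorial:
  assumes elgot: "complete_elgot_algebra C H A \<alpha> sol"
    and e: "e \<in> hom C X (OMap H X \<amalg> A)" and f: "f \<in> hom C Y (OMap H Y \<amalg> A)" and h: "h \<in> hom C X Y"
    and "copair C (Inl C (OMap H Y) A \<cdot> AMap H h) (Inr C (OMap H Y) A) \<cdot> e = f \<cdot> h"
  shows "sol e = sol f \<cdot> h"
proof -
  note [simp] = elgotD(2)[OF elgot] hom_Obj[OF e] hom_Obj[OF f] homE[OF h]
  have "coprod_map C (AMap H h) (Id C A) \<cdot> e = f \<cdot> h"
    using assms(5) by (simp add: coprod_map_def)
  then show ?thesis
    using elgot e f h hom_Obj[OF h] unfolding complete_elgot_algebra_def by blast
qed

text \<open>\<open>Tm f\<close> is a morphism of equations from \<open>f \<bullet> out Y\<close> to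
  \<open>out A\<close>, as one checks on \<open>\<tau>\<close> and \<open>\<eta>\<close>;
  functoriality then applies.\<close>

lemma elgot_rename_out:
  assumes elgot: "complete_elgot_algebra C H A \<alpha> sol" and f: "f \<in> hom C Y A"
  shows "sol (rename_params C H f (out Y)) = sol (out A) \<cdot> Tm f"
proof -
  note [simp] = homE[OF f] hom_Obj[OF f]
  have out: "out Y \<in> hom C (T Y) (OMap H (T Y) \<amalg> Y)"
    by (simp add: out_in_hom)
  show ?thesis
  proof (rule elgot_functorial[OF elgot rename_params_in_hom[OF out f]])
    show "copair C (Inl C (OMap H (T A)) A \<cdot> AMap H (Tm f)) (Inr C (OMap H (T A)) A) \<cdot>
      rename_params C H f (out Y) = out A \<cdot> Tm f"
      unfolding rename_params_eq[OF out f hom_Obj(1)[OF f]]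
      by (rule T_eqI[of _ Y "OMap H (T A) \<amalg> A"]) (simp_all add: hom_iff)
  qed (simp_all add: hom_iff)
qed

text \<open>Renaming parameters keeps \<open>cia_sol Y e\<close> a morphism of equations, now from
  \<open>f \<bullet> e\<close> to \<open>f \<bullet> out Y\<close>.\<close>

lemma elgot_rename:
  assumes elgot: "complete_elgot_algebra C H A \<alpha> sol" and f: "f \<in> hom C Y A"
    and e: "e \<in> hom C X (OMap H X \<amalg> Y)"
  shows "sol (rename_params C H f e) = sol (out A) \<cdot> Tm f \<cdot> cia_sol Y e"
proof -
  have Y: "Y \<in> Obj C" and A: "A \<in> Obj C"
    using hom_Obj[OF f] by auto
  note [simp] = homE[OF f] homE[OF e] hom_Obj[OF e] Y A homE[OF cia_sol(1)[OF e Y]]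
    homE[OF elgotD(5)[OF elgot out_in_hom[OF A]]]
  have out: "out Y \<in> hom C (T Y) (OMap H (T Y) \<amalg> Y)"
    by (simp add: out_in_hom)
  have "sol (rename_params C H f e) = sol (rename_params C H f (out Y)) \<cdot> cia_sol Y e"
  proof (rule elgot_functorial[OF elgot rename_params_in_hom[OF e f Y] rename_params_in_hom[OF out f Y]
        cia_sol(1)[OF e Y]])
    show "copair C (Inl C (OMap H (T Y)) A \<cdot> AMap H (cia_sol Y e)) (Inr C (OMap H (T Y)) A) \<cdot>
      rename_params C H f e = rename_params C H f (out Y) \<cdot> cia_sol Y e"
      unfolding rename_params_eq[OF e f Y] rename_params_eq[OF out f Y]
      by (simp add: out_cia_sol[OF e Y])
  qed
  then show ?thesis
    by (simp add: elgot_rename_out[OF elgot f])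
qed

text \<open>The case \<open>f = id\<close> of \<open>elgot_rename\<close>. Hence the whole solution
  assignment is determined by its value at \<open>out A\<close>.\<close>

lemma elgot_sol:
  assumes elgot: "complete_elgot_algebra C H A \<alpha> sol" and e: "e \<in> hom C X (OMap H X \<amalg> A)"
  shows "sol e = sol (out A) \<cdot> cia_sol A e"
proof -
  have A: "A \<in> Obj C"
    using elgotD(2)[OF elgot] .
  show ?thesis
    using elgot_rename[OF elgot Id_in_hom[OF A] e] homE[OF cia_sol(1)[OF e A]]
    by (simp add: rename_params_Id[OF e A] Tm_Id A)
qed

definition em_algebra :: "'o \<Rightarrow> 'm \<Rightarrow> bool" where
  "em_algebra A a \<longleftrightarrow> A \<in> Obj C \<and> a \<in> hom C (T A) A \<and> a \<cdot> \<eta> A = Id C A \<and> a \<cdot> \<mu> A = a \<cdot> Tm a"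

text \<open>The unit law and the second claim are the fixed-point equation of \<open>out A\<close>
  read on \<open>\<eta>\<close> and on \<open>\<tau>\<close>; associativity combines
  compositionality with functoriality. The second claim lets \<open>em_struct_elgot\<close> recover
  \<open>\<alpha>\<close>.\<close>

lemma elgot_to_em:
  assumes elgot: "complete_elgot_algebra C H A \<alpha> sol"
  shows "em_algebra A (sol (out A))"
    and "sol (out A) \<cdot> \<tau> A = \<alpha> \<cdot> AMap H (sol (out A))"
proof -
  have A: "A \<in> Obj C"
    using elgotD(2)[OF elgot] .
  let ?a = "sol (out A)"
  have out: "out A \<in> hom C (T A) (OMap H (T A) \<amalg> A)"
    by (rule out_in_hom[OF A])
  have out': "out (T A) \<in> hom C (T (T A)) (OMap H (T (T A)) \<amalg> T A)"
    by (simp add: out_in_hom A)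
  note a = elgotD(5)[OF elgot out]
  note [simp] = A homE[OF a] homE[OF elgotD(3)[OF elgot]]
  have a_eq: "?a \<cdot> k = copair C (\<alpha> \<cdot> AMap H ?a) (Id C A) \<cdot> out A \<cdot> k" if "k \<in> Arr C" "Cod C k = T A" for k
  proof -
    have "?a \<cdot> k = (copair C (\<alpha> \<cdot> AMap H ?a) (Id C A) \<cdot> out A) \<cdot> k"
      by (simp only: elgotD(6)[OF elgot out])
    then show ?thesis
      using that by simp
  qed
  have unit: "?a \<cdot> \<eta> A = Id C A" and struct: "?a \<cdot> \<tau> A = \<alpha> \<cdot> AMap H ?a"
    by (simp_all add: a_eq)
  note p = plus_eq_in_hom[OF out' out A]
  \<comment> \<open>\<open>[\<mu>, id]\<close> is a morphism of equations from
    \<open>out A \<oplus> out (T A)\<close> to \<open>out A\<close>; on the first summand this says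
    that \<open>\<mu>\<close> respects \<open>out\<close>.\<close>
  have "sol (plus_eq C H A (out A) (out (T A))) = ?a \<cdot> copair C (\<mu> A) (Id C (T A))"
  proof (rule elgot_functorial[OF elgot p out])
    show "copair C (Inl C (OMap H (T A)) A \<cdot> AMap H (copair C (\<mu> A) (Id C (T A))))
        (Inr C (OMap H (T A)) A) \<cdot> plus_eq C H A (out A) (out (T A)) =
      out A \<cdot> copair C (\<mu> A) (Id C (T A))"
    proof -
      have "copair C (Inl C (OMap H (T A)) A \<cdot> AMap H (\<mu> A)) (out A) \<cdot> out (T A) = out A \<cdot> \<mu> A"
        by (rule T_eqI[of _ "T A" "OMap H (T A) \<amalg> A"]) (simp_all add: hom_iff)
      then show ?thesis
        unfolding plus_eq_eq[OF out' out A] by simp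
    qed
  qed (simp add: hom_iff)
  \<comment> \<open>In this instance of compositionality the left side is
    \<open>?a \<cdot> Tm ?a\<close> and the right side becomes
    \<open>?a \<cdot> \<mu> A\<close>.\<close>
  moreover have "sol (rename_params C H ?a (out (T A))) =
      sol (plus_eq C H A (out A) (out (T A))) \<cdot> Inl C (T (T A)) (T A)"
    using elgot out out' unfolding complete_elgot_algebra_def by simp
  ultimately have "?a \<cdot> \<mu> A = ?a \<cdot> Tm ?a"
    by (simp add: elgot_rename_out[OF elgot a])
  then show "em_algebra A ?a" "?a \<cdot> \<tau> A = \<alpha> \<cdot> AMap H ?a"
    using unit struct a A by (simp_all add: em_algebra_def)
qed

text \<open>Preservation at the single equation \<open>out A\<close> is the Eilenberg--Moore
  condition, by \<open>elgot_rename_out\<close>. It implies preservation everywhere because all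
  solutions factor through \<open>cia_sol\<close>.\<close>

lemma solution_preserving_iff:
  assumes elgot: "complete_elgot_algebra C H A \<alpha> sol" "complete_elgot_algebra C H B \<beta> sol'"
    and h: "h \<in> hom C A B"
  shows "solution_preserving C H A sol sol' h \<longleftrightarrow> h \<cdot> sol (out A) = sol' (out B) \<cdot> Tm h"
proof
  have A: "A \<in> Obj C" and B: "B \<in> Obj C"
    using hom_Obj[OF h] by auto
  note [simp] = A B homE[OF h] homE[OF elgotD(5)[OF elgot(1) out_in_hom[OF A]]]
    homE[OF elgotD(5)[OF elgot(2) out_in_hom[OF B]]]
  show "h \<cdot> sol (out A) = sol' (out B) \<cdot> Tm h" if "solution_preserving C H A sol sol' h"
    using that flat_eqsI[OF out_in_hom[OF A]] elgot_rename_out[OF elgot(2) h]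
    by (simp add: solution_preserving_def)
  show "solution_preserving C H A sol sol' h" if eq: "h \<cdot> sol (out A) = sol' (out B) \<cdot> Tm h"
    unfolding solution_preserving_def
  proof
    fix e assume "e \<in> flat_eqs C H A"
    then obtain X where e: "e \<in> hom C X (OMap H X \<amalg> A)"
      by (rule flat_eqsE)
    note [simp] = homE[OF cia_sol(1)[OF e A]]
    have "h \<cdot> sol e = (h \<cdot> sol (out A)) \<cdot> cia_sol A e"
      by (simp add: elgot_sol[OF elgot(1) e])
    also have "\<dots> = sol' (rename_params C H h e)"
      unfolding eq by (simp add: elgot_rename[OF elgot(2) h e])
    finally show "h \<cdot> sol e = sol' (rename_params C H h e)" .
  qed
qed


section \<open>From Eilenberg--Moore algebras to complete Elgot algebras\<close>

text \<open>\<open>\<tau> A \<cdot> H (\<eta> A)\<close> is the component at \<open>A\<close> of the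
  canonical transformation from \<open>H\<close> to \<open>T\<close>; the \<open>T\<close>-algebra
  \<open>a\<close> is restricted along it.\<close>

definition em_struct :: "'o \<Rightarrow> 'm \<Rightarrow> 'm" where
  "em_struct A a = a \<cdot> \<tau> A \<cdot> AMap H (\<eta> A)"

definition em_sol :: "'o \<Rightarrow> 'm \<Rightarrow> 'm \<Rightarrow> 'm" where
  "em_sol A a = (\<lambda>e \<in> flat_eqs C H A. a \<cdot> cia_sol A e)"

lemma em_sol_eq: "e \<in> hom C X (OMap H X \<amalg> A) \<Longrightarrow> em_sol A a e = a \<cdot> cia_sol A e"
  by (simp add: em_sol_def flat_eqsI)

lemma em_sol_extensional: "em_sol A a \<in> extensional (flat_eqs C H A)"
  by (simp add: em_sol_def)

text \<open>In other words, \<open>a\<close> is a homomorphism from the free algebra: naturality of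
  \<open>\<eta>\<close> moves \<open>a\<close> past it as \<open>Tm a\<close>, associativity turns
  \<open>a \<cdot> Tm a\<close> into \<open>a \<cdot> \<mu> A\<close>, and \<open>\<mu> A\<close>
  cancels \<open>\<eta> (T A)\<close>.\<close>

lemma em_struct_Comp:
  assumes "em_algebra A a"
  shows "em_struct A a \<cdot> AMap H a = a \<cdot> \<tau> A"
proof -
  have A: "A \<in> Obj C" and a: "a \<in> hom C (T A) A" and mult: "a \<cdot> \<mu> A = a \<cdot> Tm a"
    using assms by (auto simp: em_algebra_def)
  note [simp] = A homE[OF a]
  have H\<eta>: "AMap H (\<eta> A) \<cdot> AMap H a = AMap H (Tm a) \<cdot> AMap H (\<eta> (T A))"
    using H.AMap_Comp_simp[of a "\<eta> A"] H.AMap_Comp_simp[of "\<eta> (T A)" "Tm a"] by simp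
  have H\<mu>: "AMap H (\<mu> A) \<cdot> AMap H (\<eta> (T A)) = Id C (OMap H (T A))"
    using H.AMap_Comp_simp[of "\<eta> (T A)" "\<mu> A"] by simp
  have "em_struct A a \<cdot> AMap H a = (a \<cdot> Tm a) \<cdot> \<tau> (T A) \<cdot> AMap H (\<eta> (T A))"
    by (simp add: em_struct_def H\<eta>)
  also have "\<dots> = a \<cdot> \<tau> A"
    unfolding mult[symmetric] by (simp add: H\<mu>)
  finally show ?thesis .
qed

text \<open>Each law follows from the one for \<open>cia_sol\<close> by composing with
  \<open>a\<close>. Solutions are preserved since \<open>a\<close> is a homomorphism with
  \<open>a \<cdot> \<eta> A = id\<close>; compositionality uses
  \<open>a \<cdot> \<mu> A = a \<cdot> Tm a\<close>.\<close>

lemma em_to_elgot: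
  assumes em: "em_algebra A a"
  shows "complete_elgot_algebra C H A (em_struct A a) (em_sol A a)"
proof -
  have A: "A \<in> Obj C" and a: "a \<in> hom C (T A) A" and unit: "a \<cdot> \<eta> A = Id C A"
    and mult: "a \<cdot> \<mu> A = a \<cdot> Tm a"
    using em by (auto simp: em_algebra_def)
  note [simp] = A homE[OF a]
  have \<alpha>: "em_struct A a \<in> hom C (OMap H A) A"
    by (simp add: em_struct_def hom_iff)
  note [simp] = homE[OF \<alpha>]
  have alg: "is_algebra C H A (em_struct A a)"
    using \<alpha> by (simp add: is_algebra_def)
  have "is_solution C H A (em_struct A a) e (em_sol A a e)" if e: "e \<in> hom C X (OMap H X \<amalg> A)" for e X
  proof -
    note [simp] = homE[OF e] hom_Obj[OF e] homE[OF cia_sol(1)[OF e A]]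
    have "copair C (em_struct A a \<cdot> AMap H (a \<cdot> cia_sol A e)) (Id C A) \<cdot> e =
        copair C ((em_struct A a \<cdot> AMap H a) \<cdot> AMap H (cia_sol A e)) (Id C A) \<cdot> e"
      by simp
    also have "\<dots> = a \<cdot> copair C (\<tau> A \<cdot> AMap H (cia_sol A e)) (\<eta> A) \<cdot> e"
      unfolding em_struct_Comp[OF em] by (simp add: unit)
    also have "\<dots> = a \<cdot> cia_sol A e"
      by (simp only: cia_sol(2)[OF e A])
    finally show ?thesis
      unfolding is_solution_iff[OF alg e] em_sol_eq[OF e] by (simp add: hom_iff)
  qed
  moreover have "em_sol A a e = em_sol A a f \<cdot> h"
    if "e \<in> hom C X (OMap H X \<amalg> A)" "f \<in> hom C Y (OMap H Y \<amalg> A)" "h \<in> hom C X Y"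
      "coprod_map C (AMap H h) (Id C A) \<cdot> e = f \<cdot> h" for e f h X Y
    using cia_sol_functorial[OF that(1-3) A that(4)] homE[OF that(3)] homE[OF cia_sol(1)[OF that(2) A]]
    by (simp add: em_sol_eq[OF that(1)] em_sol_eq[OF that(2)])
  moreover have "em_sol A a (rename_params C H (em_sol A a f) e) =
      em_sol A a (plus_eq C H A f e) \<cdot> Inl C X Y"
    if e: "e \<in> hom C X (OMap H X \<amalg> Y)" and f: "f \<in> hom C Y (OMap H Y \<amalg> A)" for e f X Y
  proof -
    have Y: "Y \<in> Obj C"
      using hom_Obj[OF f] by simp
    note [simp] = hom_Obj[OF e] Y homE[OF cia_sol(1)[OF e Y]] homE[OF cia_sol(1)[OF f A]]
      homE[OF cia_sol(1)[OF plus_eq_in_hom[OF e f A] A]]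
    have f': "a \<cdot> cia_sol A f \<in> hom C Y A"
      by (simp add: hom_iff)
    have "em_sol A a (rename_params C H (em_sol A a f) e) = (a \<cdot> Tm a) \<cdot> Tm (cia_sol A f) \<cdot> cia_sol Y e"
      by (simp add: em_sol_eq[OF f] em_sol_eq[OF rename_params_in_hom[OF e f' Y]]
          cia_sol_rename[OF e f'] Tm_Comp)
    also have "\<dots> = a \<cdot> \<mu> A \<cdot> Tm (cia_sol A f) \<cdot> cia_sol Y e"
      unfolding mult[symmetric] by simp
    also have "\<dots> = em_sol A a (plus_eq C H A f e) \<cdot> Inl C X Y"
      by (simp add: em_sol_eq[OF plus_eq_in_hom[OF e f A]] cia_sol_compositional[OF e f A])
    finally show ?thesis .
  qed
  ultimately show ?thesis
    unfolding complete_elgot_algebra_def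
    using alg em_sol_extensional by (auto elim!: flat_eqsE)
qed

lemma em_sol_out: "em_algebra A a \<Longrightarrow> em_sol A a (out A) = a"
  using em_sol_eq[OF out_in_hom] by (auto simp: em_algebra_def cia_sol_out hom_iff)

text \<open>As \<open>?a\<close> is a homomorphism, \<open>?a \<cdot> \<tau> A \<cdot> H \<eta> =
  \<alpha> \<cdot> H (?a \<cdot> \<eta> A)\<close>, and the unit law removes the last
  factor.\<close>

lemma em_struct_elgot:
  assumes elgot: "complete_elgot_algebra C H A \<alpha> sol"
  shows "em_struct A (sol (out A)) = \<alpha>"
proof -
  have A: "A \<in> Obj C"
    using elgotD(2)[OF elgot] .
  let ?a = "sol (out A)"
  have unit: "?a \<cdot> \<eta> A = Id C A"
    using elgot_to_em(1)[OF elgot] by (simp add: em_algebra_def)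
  note [simp] = A homE[OF elgotD(5)[OF elgot out_in_hom[OF A]]] homE[OF elgotD(3)[OF elgot]]
  have "em_struct A ?a = (?a \<cdot> \<tau> A) \<cdot> AMap H (\<eta> A)"
    by (simp add: em_struct_def)
  also have "\<dots> = \<alpha> \<cdot> AMap H (?a \<cdot> \<eta> A)"
    unfolding elgot_to_em(2)[OF elgot] by simp
  also have "\<dots> = \<alpha>"
    unfolding unit by simp
  finally show ?thesis .
qed

text \<open>On flat equations this is \<open>elgot_sol\<close>; elsewhere both sides agree by
  extensionality.\<close>

lemma em_sol_elgot:
  assumes elgot: "complete_elgot_algebra C H A \<alpha> sol"
  shows "em_sol A (sol (out A)) = sol"
proof (rule extensionalityI)
  show "em_sol A (sol (out A)) \<in> extensional (flat_eqs C H A)"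
    by (rule em_sol_extensional)
  show "sol \<in> extensional (flat_eqs C H A)"
    by (rule elgotD(4)[OF elgot])
  show "em_sol A (sol (out A)) e = sol e" if "e \<in> flat_eqs C H A" for e
    using flat_eqsE[OF that] elgot_sol[OF elgot] em_sol_eq by metis
qed

section \<open>The isomorphism of categories\<close>

lemma CElgot_isomorphic_eilenberg_moore:
  "isomorphic_categories (CElgot C H) (eilenberg_moore C (free_ci_monad C H))"
proof -
  have em: "eilenberg_moore C (free_ci_monad C H) =
    category_over C {(A, a). em_algebra A a} fst (\<lambda>(A, a) h (B, b). h \<cdot> a = b \<cdot> Tm h)"
    unfolding eilenberg_moore_def em_algebra_def by (simp add: free_ci_monad_def)
  show ?thesis
    unfolding CElgot_def em
  \<comment> \<open>Both object maps keep the carrier. The Eilenberg--Moore side is the primed one,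
    so closure under identities and composition is checked there, from functoriality of
    \<open>Tm\<close>.\<close>
  proof (rule isomorphic_category_over[where F = "\<lambda>(A, \<alpha>, sol). (A, sol (out A))"
        and G = "\<lambda>(A, a). (A, em_struct A a, em_sol A a)"])
    show "category C"
      by (rule category_axioms)
  next
    fix x assume "x \<in> {(A, a). em_algebra A a}"
    then obtain A a where x: "x = (A, a)" "em_algebra A a"
      by auto
    then show "fst x \<in> Obj C"
      "(\<lambda>(A, a) h (B, b). h \<cdot> a = b \<cdot> Tm h) x (Id C (fst x)) x"
      by (auto simp: em_algebra_def Tm_Id hom_iff)
    show "(case x of (A, a) \<Rightarrow> (A, em_struct A a, em_sol A a)) \<in> {(A, \<alpha>, sol). complete_elgot_algebra C H A \<alpha> sol}"
      "(case case x of (A, a) \<Rightarrow> (A, em_struct A a, em_sol A a) of (A, \<alpha>, sol) \<Rightarrow> (A, sol (out A))) = x"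
      using x em_to_elgot em_sol_out by auto
  next
    fix x y z f g
    assume "x \<in> {(A, a). em_algebra A a}" "y \<in> {(A, a). em_algebra A a}" "z \<in> {(A, a). em_algebra A a}"
      and fg: "f \<in> hom C (fst x) (fst y)" "g \<in> hom C (fst y) (fst z)"
      "(\<lambda>(A, a) h (B, b). h \<cdot> a = b \<cdot> Tm h) x f y" "(\<lambda>(A, a) h (B, b). h \<cdot> a = b \<cdot> Tm h) y g z"
    then obtain A a B b D d where xyz: "x = (A, a)" "y = (B, b)" "z = (D, d)"
      and a: "a \<in> hom C (T A) A" and b: "b \<in> hom C (T B) B" and d: "d \<in> hom C (T D) D"
      by (auto simp: em_algebra_def)
    have f: "f \<in> hom C A B" and g: "g \<in> hom C B D" and fa: "f \<cdot> a = b \<cdot> Tm f" and gb: "g \<cdot> b = d \<cdot> Tm g"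
      using fg xyz by auto
    note [simp] = homE[OF a] homE[OF b] homE[OF d] homE[OF f] homE[OF g]
    have "(g \<cdot> f) \<cdot> a = g \<cdot> b \<cdot> Tm f"
      by (simp add: fa)
    also have "\<dots> = (g \<cdot> b) \<cdot> Tm f"
      by simp
    also have "\<dots> = d \<cdot> Tm (g \<cdot> f)"
      unfolding gb by (simp add: Tm_Comp)
    finally show "(\<lambda>(A, a) h (B, b). h \<cdot> a = b \<cdot> Tm h) x (g \<cdot> f) z"
      by (simp add: xyz)
  next
    fix x assume "x \<in> {(A, \<alpha>, sol). complete_elgot_algebra C H A \<alpha> sol}"
    then show "(case x of (A, \<alpha>, sol) \<Rightarrow> (A, sol (out A))) \<in> {(A, a). em_algebra A a}"
      "fst (case x of (A, \<alpha>, sol) \<Rightarrow> (A, sol (out A))) = fst x"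
      "(case case x of (A, \<alpha>, sol) \<Rightarrow> (A, sol (out A)) of (A, a) \<Rightarrow> (A, em_struct A a, em_sol A a)) = x"
      using elgot_to_em(1) em_struct_elgot em_sol_elgot by auto
  next
    fix x y h
    assume "x \<in> {(A, \<alpha>, sol). complete_elgot_algebra C H A \<alpha> sol}"
      "y \<in> {(A, \<alpha>, sol). complete_elgot_algebra C H A \<alpha> sol}" "h \<in> hom C (fst x) (fst y)"
    then show "(\<lambda>(A, \<alpha>, solA) h (B, \<beta>, solB). solution_preserving C H A solA solB h) x h y \<longleftrightarrow>
      (\<lambda>(A, a) h (B, b). h \<cdot> a = b \<cdot> Tm h) (case x of (A, \<alpha>, sol) \<Rightarrow> (A, sol (out A))) h
        (case y of (A, \<alpha>, sol) \<Rightarrow> (A, sol (out A)))"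
      using solution_preserving_iff by auto
  qed
qed

end

theorem theorem5p8:
  fixes C :: "('o, 'm, 'z) coprod_category_scheme"
    and H :: "('o, 'm, 'o, 'm) func"
  assumes "finite_coproduct_category C"
    and "cat_functor C C H"
    and "iteratable C H"
  shows "isomorphic_categories (CElgot C H) (eilenberg_moore C (free_ci_monad C H))"
proof -
  interpret iteratable_endofunctor C H
    using assms
    by (simp add: iteratable_endofunctor_def coprod_endofunctor_def iteratable_endofunctor_axioms_def)
  show ?thesis
    by (rule CElgot_isomorphic_eilenberg_moore)
qed

end
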